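(* Let $M$ be a connected smooth manifold of dimension $n\ge3$ with a Riemannian conformal structure $c$. Let $g\in c$ and let $\gamma$ be an admissible family, with associated $\delta>0$, satisfying $g(\dot\gamma(0)(-),-)=2P^g$, where $P^g$ is the Schouten tensor of $g$. Let $(\widetilde M,\widetilde g)$ be the Lorentzian manifold constructed from $g$ and $\gamma$, let $\Psi\colon M\to\widetilde M$, $\Psi(x)=(1,0,x)$, and let $\xi=\partial_t|_\Psi$. Let $\bigl(\Psi^*(T\widetilde M),\mathrm{Span}(\xi),\widetilde g,\widetilde\nabla\bigr)$ be the normal conformal tractor bundle associated with the pair $(\Psi,\xi)$. Then a vector field along $\Psi$, $W\in\overline{\mathfrak X}(M)=\Gamma(\Psi^*(T\widetilde M))$, is a parallel section of this bundle (i.e. $\widetilde\nabla_VW=0$ for every $V\in\mathfrak X(M)$) if and only if $$\left\{\begin{aligned}&\nabla_VW^\top=A_{W^\perp}V,\\ &\mathrm{II}(V,W^\top)+\nabla^\perp_VW^\perp=0,\end{aligned}\right.$$ for every $V\in\mathfrak X(M)$.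
   Context: **Schouten tensor.** $P^g=\frac1{n-2}\Bigl(\mathrm{Ric}^g-\frac{\mathrm S^g}{2(n-1)}g\Bigr)$, with $\mathrm{Ric}^g$ and $\mathrm S^g$ the Ricci and scalar curvatures of $g$. **Admissible family.** A smooth one-parameter family $\gamma$ of $(1,1)$-tensor fields $\gamma(r)$, $r\in\mathbb R$, on $M$ is admissible for $(M,c)$ if: (1) each $\gamma(r)$ is self-adjoint with respect to any metric of $c$; (2) $\gamma(0)=\mathrm{Id}$; (3) there is $\delta>0$ such that $\gamma(r)$ is nonsingular for all $|r|<\delta$. $\dot\gamma$ is the derivative of $\gamma$ in $r$. **The Lorentzian manifold.** $\widetilde M=\mathbb R_{>0}\times(-\delta,\delta)\times M$, with coordinates $(t,r)$ on the first two factors, and $$\widetilde g=d(rt)\otimes dt+dt\otimes d(rt)+t^2\,g(\gamma(r)(-),-).$$ **The immersion and the bundle.** $\Psi$ is a spacelike immersion with $\Psi^*(\widetilde g)=g$, and its normal bundle has the global lightlike frame $\xi=\partial_t|_\Psi$, $\ell=-\partial_r|_\Psi$, $\widetilde g(\xi,\ell)=-1$. The tractor bundle associated with $(\Psi,\xi)$ is the pullback bundle $\Psi^*(T\widetilde M)\to M$ with distinguished lightlike line subbundle $\mathrm{Span}(\xi)$, bundle metric induced by $\widetilde g$, and connection $\widetilde\nabla$ the pullback to $\Psi^*(T\widetilde M)$ of the Levi-Civita connection of $\widetilde g$. Under the assumption $g(\dot\gamma(0)(-),-)=2P^g$ this quadruple is the normal conformal tractor bundle of $(M,c)$, that is, the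 (unique up to isomorphism) standard conformal tractor bundle with normal tractor connection. **Submanifold notation.** $\nabla$ is the Levi-Civita connection of $g$. For $W\in\overline{\mathfrak X}(M)$ write $W=T\Psi\cdot W^\top+W^\perp$ with $W^\top\in\mathfrak X(M)$ and $W^\perp\in\mathfrak X^\perp(M)$ (normal vector fields along $\Psi$). The second fundamental form $\mathrm{II}$, Weingarten endomorphisms $A_\zeta$ and normal connection $\nabla^\perp$ are defined by the decomposition into tangent and normal parts $$\widetilde\nabla_V(T\Psi\cdot Z)=T\Psi\cdot\nabla_VZ+\mathrm{II}(V,Z),\qquad \widetilde\nabla_V\zeta=-T\Psi\cdot A_\zeta V+\nabla^\perp_V\zeta,$$ for $V,Z\in\mathfrak X(M)$, $\zeta\in\mathfrak X^\perp(M)$. *)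

theory Defs
  imports "HOL-Analysis.Analysis" "HOL-Library.Function_Algebras"
begin

section \<open>Smooth functions and smooth manifolds\<close>

text \<open>\<open>Ck k S f\<close>: \<open>f\<close> is \<open>k\<close> times continuously differentiable on the open set \<open>S\<close>.\<close>

primrec Ck :: "nat \<Rightarrow> 'a::real_normed_vector set \<Rightarrow> ('a \<Rightarrow> 'b::real_normed_vector) \<Rightarrow> bool" where
  "Ck 0 S f \<longleftrightarrow> continuous_on S f"
| "Ck (Suc k) S f \<longleftrightarrow> (\<forall>x\<in>S. f differentiable (at x)) \<and>
      (\<forall>v. Ck k S (\<lambda>x. frechet_derivative f (at x) v))"

definition C_infinity :: "'a::real_normed_vector set \<Rightarrow> ('a \<Rightarrow> 'b::real_normed_vector) \<Rightarrow> bool" where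
  "C_infinity S f \<longleftrightarrow> (\<forall>k. Ck k S f)"

text \<open>A chart is a pair \<open>(D, \<phi>)\<close> of an open set and a map which is a homeomorphism of \<open>D\<close> onto an
  open subset of the Euclidean space \<open>'e\<close>; the values of \<open>\<phi>\<close> off \<open>D\<close> are irrelevant. A manifold is
  given by an atlas (not necessarily maximal), its set of points being the union of the chart
  domains. Its dimension is \<open>DIM('e)\<close>.\<close>

type_synonym ('m, 'e) chart = "'m set \<times> ('m \<Rightarrow> 'e)"

definition carrier :: "('m, 'e) chart set \<Rightarrow> 'm set" where
  "carrier A = (\<Union>(D, \<phi>)\<in>A. D)"

definition smooth_manifold ::
  "('m::{t2_space,second_countable_topology}, 'e::euclidean_space) chart set \<Rightarrow> bool" where
  "smooth_manifold A \<longleftrightarrow>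
     (\<forall>(D, \<phi>)\<in>A. open D \<and> open (\<phi> ` D) \<and> homeomorphism D (\<phi> ` D) \<phi> (inv_into D \<phi>)) \<and>
     (\<forall>(D, \<phi>)\<in>A. \<forall>(E, \<psi>)\<in>A. C_infinity (\<phi> ` (D \<inter> E)) (\<psi> \<circ> inv_into D \<phi>))"

definition open_times :: "'s set \<Rightarrow> ('m, 'e) chart set \<Rightarrow> ('s \<times> 'm, 's \<times> 'e) chart set" where
  "open_times I A = (\<lambda>(D, \<phi>). (I \<times> D, \<lambda>(s, x). (s, \<phi> x))) ` A"

definition smooth_fun ::
  "('m, 'e::real_normed_vector) chart set \<Rightarrow> 'm set \<Rightarrow> ('m \<Rightarrow> real) \<Rightarrow> bool" where
  "smooth_fun A U f \<longleftrightarrow> (\<forall>(D, \<phi>)\<in>A. C_infinity (\<phi> ` (U \<inter> D)) (f \<circ> inv_into D \<phi>))"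

definition smooth_near ::
  "('m::topological_space, 'e::real_normed_vector) chart set \<Rightarrow> 'm \<Rightarrow> ('m \<Rightarrow> real) \<Rightarrow> bool" where
  "smooth_near A p f \<longleftrightarrow> (\<exists>U. open U \<and> p \<in> U \<and> U \<subseteq> carrier A \<and> smooth_fun A U f)"


section \<open>Tangent vectors and vector fields\<close>

text \<open>A tangent vector at \<open>p\<close> is the directional derivative, in some chart around \<open>p\<close>, along a vector
  \<open>w\<close> of the model space, acting on functions that are smooth near \<open>p\<close>. It is set to \<open>0\<close> on all
  other functions, so that equality of tangent vectors is equality of operators. The vector space
  operations \<open>+\<close>, \<open>-\<close>, \<open>0\<close> are the pointwise ones.\<close>

type_synonym 'm tvec = "('m \<Rightarrow> real) \<Rightarrow> real"

definition tscale :: "real \<Rightarrow> 'm tvec \<Rightarrow> 'm tvec" (infixr "*\<^sub>T" 75) where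
  "a *\<^sub>T v = (\<lambda>f. a * v f)"

definition tangent_space ::
  "('m::topological_space, 'e::euclidean_space) chart set \<Rightarrow> 'm \<Rightarrow> 'm tvec set" where
  "tangent_space A p =
     {v. \<exists>(D, \<phi>)\<in>A. p \<in> D \<and> (\<exists>w. v = (\<lambda>f. if smooth_near A p f
            then frechet_derivative (f \<circ> inv_into D \<phi>) (at (\<phi> p)) w else 0))}"

definition tmap ::
  "('n::topological_space, 'f::euclidean_space) chart set \<Rightarrow> ('m \<Rightarrow> 'n) \<Rightarrow> 'm \<Rightarrow> 'm tvec \<Rightarrow> 'n tvec" where
  "tmap B F p v = (\<lambda>f. if smooth_near B (F p) f then v (f \<circ> F) else 0)"

text \<open>Smooth vector fields along \<open>F\<close> over the open set \<open>U\<close>, i.e. smooth sections over \<open>U\<close> of the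
  pullback bundle of the tangent bundle of \<open>B\<close> under \<open>F\<close>. Vector fields are those along the
  identity.\<close>

definition fields_along ::
  "('m::topological_space, 'e::euclidean_space) chart set \<Rightarrow>
   ('n::topological_space, 'f::euclidean_space) chart set \<Rightarrow>
   ('m \<Rightarrow> 'n) \<Rightarrow> 'm set \<Rightarrow> ('m \<Rightarrow> 'n tvec) set" where
  "fields_along A B F U =
     {W. (\<forall>p\<in>U. W p \<in> tangent_space B (F p)) \<and>
         (\<forall>N f. open N \<and> N \<subseteq> carrier B \<and> smooth_fun B N f \<longrightarrow>
            smooth_fun A (U \<inter> F -` N) (\<lambda>p. W p f))}"

definition vfields ::
  "('m::topological_space, 'e::euclidean_space) chart set \<Rightarrow> 'm set \<Rightarrow> ('m \<Rightarrow> 'm tvec) set" where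
  "vfields A U = fields_along A A (\<lambda>x. x) U"

abbreviation global_vfields ::
  "('m::topological_space, 'e::euclidean_space) chart set \<Rightarrow> ('m \<Rightarrow> 'm tvec) set" (\<open>\<XX>\<close>) where
  "\<XX> A \<equiv> vfields A (carrier A)"

definition lie_bracket ::
  "('m::topological_space, 'e::euclidean_space) chart set \<Rightarrow> ('m \<Rightarrow> 'm tvec) \<Rightarrow> ('m \<Rightarrow> 'm tvec) \<Rightarrow>
   'm \<Rightarrow> 'm tvec" where
  "lie_bracket A X Y p =
     (\<lambda>f. if smooth_near A p f then X p (\<lambda>q. Y q f) - Y p (\<lambda>q. X q f) else 0)"


section \<open>Metrics and connections\<close>

type_synonym 'm metric_tensor = "'m \<Rightarrow> 'm tvec \<Rightarrow> 'm tvec \<Rightarrow> real"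

definition riemannian_metric ::
  "('m::topological_space, 'e::euclidean_space) chart set \<Rightarrow> 'm metric_tensor \<Rightarrow> bool" where
  "riemannian_metric A g \<longleftrightarrow>
     (\<forall>p\<in>carrier A. \<forall>u\<in>tangent_space A p. \<forall>v\<in>tangent_space A p. \<forall>w\<in>tangent_space A p. \<forall>a b.
        g p (a *\<^sub>T u + b *\<^sub>T v) w = a * g p u w + b * g p v w) \<and>
     (\<forall>p\<in>carrier A. \<forall>v\<in>tangent_space A p. \<forall>w\<in>tangent_space A p. g p v w = g p w v) \<and>
     (\<forall>p\<in>carrier A. \<forall>v\<in>tangent_space A p. v \<noteq> 0 \<longrightarrow> g p v v > 0) \<and>
     (\<forall>U. open U \<and> U \<subseteq> carrier A \<longrightarrow> (\<forall>X\<in>vfields A U. \<forall>Y\<in>vfields A U.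
        smooth_fun A U (\<lambda>p. g p (X p) (Y p))))"

definition riemannian_conformal_structure ::
  "('m::topological_space, 'e::euclidean_space) chart set \<Rightarrow> 'm metric_tensor set \<Rightarrow> bool" where
  "riemannian_conformal_structure A c \<longleftrightarrow> c \<noteq> {} \<and>
     (\<forall>g\<in>c. riemannian_metric A g \<and>
        c = {h. riemannian_metric A h \<and> (\<exists>f. smooth_fun A (carrier A) f \<and>
               (\<forall>p\<in>carrier A. \<forall>v\<in>tangent_space A p. \<forall>w\<in>tangent_space A p.
                  h p v w = exp (2 * f p) * g p v w))})"

text \<open>A linear connection on the pullback of the tangent bundle of \<open>B\<close> under \<open>F\<close>. The value
  \<open>D p v W\<close> is the covariant derivative of the section \<open>W\<close> in the direction of the tangent vector
  \<open>v\<close> at \<open>p\<close>.\<close>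

type_synonym ('m, 'n) connection = "'m \<Rightarrow> 'm tvec \<Rightarrow> ('m \<Rightarrow> 'n tvec) \<Rightarrow> 'n tvec"

definition linear_connection ::
  "('m::topological_space, 'e::euclidean_space) chart set \<Rightarrow>
   ('n::topological_space, 'f::euclidean_space) chart set \<Rightarrow>
   ('m \<Rightarrow> 'n) \<Rightarrow> ('m, 'n) connection \<Rightarrow> bool" where
  "linear_connection A B F D \<longleftrightarrow>
     (let M = carrier A; \<Gamma> = fields_along A B F (carrier A) in
     (\<forall>V\<in>\<XX> A. \<forall>W\<in>\<Gamma>. (\<lambda>p. D p (V p) W) \<in> \<Gamma>) \<and>
     (\<forall>p\<in>M. \<forall>v\<in>tangent_space A p. \<forall>W\<in>\<Gamma>. D p v W \<in> tangent_space B (F p)) \<and>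
     (\<forall>p\<in>M. \<forall>u\<in>tangent_space A p. \<forall>v\<in>tangent_space A p. \<forall>a b. \<forall>W\<in>\<Gamma>.
        D p (a *\<^sub>T u + b *\<^sub>T v) W = a *\<^sub>T D p u W + b *\<^sub>T D p v W) \<and>
     (\<forall>p\<in>M. \<forall>v\<in>tangent_space A p. \<forall>W\<in>\<Gamma>. \<forall>Z\<in>\<Gamma>.
        D p v (\<lambda>q. W q + Z q) = D p v W + D p v Z) \<and>
     (\<forall>p\<in>M. \<forall>v\<in>tangent_space A p. \<forall>W\<in>\<Gamma>. \<forall>f. smooth_fun A M f \<longrightarrow>
        D p v (\<lambda>q. f q *\<^sub>T W q) = v f *\<^sub>T W p + f p *\<^sub>T D p v W))"

definition levi_civita ::
  "('m::topological_space, 'e::euclidean_space) chart set \<Rightarrow> 'm metric_tensor \<Rightarrow>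
   ('m, 'm) connection \<Rightarrow> bool" where
  "levi_civita A g nab \<longleftrightarrow>
     linear_connection A A (\<lambda>x. x) nab \<and>
     (\<forall>X\<in>\<XX> A. \<forall>Y\<in>\<XX> A. \<forall>p\<in>carrier A.
        nab p (X p) Y - nab p (Y p) X = lie_bracket A X Y p) \<and>
     (\<forall>p\<in>carrier A. \<forall>v\<in>tangent_space A p. \<forall>Y\<in>\<XX> A. \<forall>Z\<in>\<XX> A.
        v (\<lambda>q. g q (Y q) (Z q)) = g p (nab p v Y) (Z p) + g p (Y p) (nab p v Z))"

text \<open>The pullback under \<open>F\<close> of a connection \<open>nab\<close> on the tangent bundle of \<open>B\<close> is the unique linear
  connection satisfying the chain rule on sections of the form \<open>Y \<circ> F\<close>.\<close>

definition pullback_connection ::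
  "('m::topological_space, 'e::euclidean_space) chart set \<Rightarrow>
   ('n::topological_space, 'f::euclidean_space) chart set \<Rightarrow>
   ('m \<Rightarrow> 'n) \<Rightarrow> ('n, 'n) connection \<Rightarrow> ('m, 'n) connection \<Rightarrow> bool" where
  "pullback_connection A B F nab D \<longleftrightarrow>
     linear_connection A B F D \<and>
     (\<forall>p\<in>carrier A. \<forall>v\<in>tangent_space A p. \<forall>Y\<in>\<XX> B.
        D p v (\<lambda>q. Y (F q)) = nab (F p) (tmap B F p v) Y)"


section \<open>Curvature\<close>

definition curvature ::
  "('m::topological_space, 'e::euclidean_space) chart set \<Rightarrow> ('m, 'm) connection \<Rightarrow>
   ('m \<Rightarrow> 'm tvec) \<Rightarrow> ('m \<Rightarrow> 'm tvec) \<Rightarrow> ('m \<Rightarrow> 'm tvec) \<Rightarrow> 'm \<Rightarrow> 'm tvec" where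
  "curvature A nab X Y Z p =
     nab p (X p) (\<lambda>q. nab q (Y q) Z) - nab p (Y p) (\<lambda>q. nab q (X q) Z)
       - nab p (lie_bracket A X Y p) Z"

text \<open>The curvature is tensorial, so its value on tangent vectors at \<open>p\<close> does not depend on the choice
  of the extensions. Likewise the traces below do not depend on the choice of the orthonormal basis
  (indexed by the standard basis of the model space).\<close>

definition extension ::
  "('m::topological_space, 'e::euclidean_space) chart set \<Rightarrow> 'm \<Rightarrow> 'm tvec \<Rightarrow> 'm \<Rightarrow> 'm tvec" where
  "extension A p v = (SOME X. X \<in> \<XX> A \<and> X p = v)"

definition orthonormal_basis ::
  "('m::topological_space, 'e::euclidean_space) chart set \<Rightarrow> 'm metric_tensor \<Rightarrow> 'm \<Rightarrow> 'e \<Rightarrow> 'm tvec"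
  where
  "orthonormal_basis A g p =
     (SOME e. (\<forall>i\<in>Basis. e i \<in> tangent_space A p) \<and>
              (\<forall>i\<in>Basis. \<forall>j\<in>Basis. g p (e i) (e j) = (if i = j then 1 else 0)))"

text \<open>\<open>Ric(v, w)\<close> is the trace of \<open>u \<mapsto> R(u, v) w\<close>.\<close>

definition ricci ::
  "('m::topological_space, 'e::euclidean_space) chart set \<Rightarrow> 'm metric_tensor \<Rightarrow> ('m, 'm) connection \<Rightarrow>
   'm \<Rightarrow> 'm tvec \<Rightarrow> 'm tvec \<Rightarrow> real" where
  "ricci A g nab p v w =
     (\<Sum>i\<in>(Basis :: 'e set). let e = orthonormal_basis A g p i in
        g p (curvature A nab (extension A p e) (extension A p v) (extension A p w) p) e)"

definition scalar_curvature ::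
  "('m::topological_space, 'e::euclidean_space) chart set \<Rightarrow> 'm metric_tensor \<Rightarrow> ('m, 'm) connection \<Rightarrow>
   'm \<Rightarrow> real" where
  "scalar_curvature A g nab p =
     (\<Sum>i\<in>(Basis :: 'e set). let e = orthonormal_basis A g p i in ricci A g nab p e e)"

definition schouten ::
  "('m::topological_space, 'e::euclidean_space) chart set \<Rightarrow> 'm metric_tensor \<Rightarrow> ('m, 'm) connection \<Rightarrow>
   'm \<Rightarrow> 'm tvec \<Rightarrow> 'm tvec \<Rightarrow> real" where
  "schouten A g nab p v w =
     1 / (real DIM('e) - 2) *
       (ricci A g nab p v w
         - scalar_curvature A g nab p / (2 * (real DIM('e) - 1)) * g p v w)"


section \<open>Admissible families and the ambient Lorentzian manifold\<close>

text \<open>Smoothness of \<open>\<gamma>\<close> is joint smoothness in \<open>r\<close> and the point of the manifold. The number \<open>\<delta>\<close> is a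
  parameter, since the ambient manifold depends on it.\<close>

definition admissible_family ::
  "('m::topological_space, 'e::euclidean_space) chart set \<Rightarrow> 'm metric_tensor set \<Rightarrow>
   (real \<Rightarrow> 'm \<Rightarrow> 'm tvec \<Rightarrow> 'm tvec) \<Rightarrow> real \<Rightarrow> bool" where
  "admissible_family A c \<gamma> \<delta> \<longleftrightarrow>
     (\<forall>r. \<forall>p\<in>carrier A. \<forall>v\<in>tangent_space A p. \<gamma> r p v \<in> tangent_space A p) \<and>
     (\<forall>r. \<forall>p\<in>carrier A. \<forall>v\<in>tangent_space A p. \<forall>w\<in>tangent_space A p. \<forall>a b.
        \<gamma> r p (a *\<^sub>T v + b *\<^sub>T w) = a *\<^sub>T \<gamma> r p v + b *\<^sub>T \<gamma> r p w) \<and>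
     (\<forall>U X f. open U \<and> U \<subseteq> carrier A \<and> X \<in> vfields A U \<and> smooth_fun A U f \<longrightarrow>
        smooth_fun (open_times UNIV A) (UNIV \<times> U) (\<lambda>(r, p). \<gamma> r p (X p) f)) \<and>
     (\<forall>h\<in>c. \<forall>r. \<forall>p\<in>carrier A. \<forall>v\<in>tangent_space A p. \<forall>w\<in>tangent_space A p.
        h p (\<gamma> r p v) w = h p v (\<gamma> r p w)) \<and>
     (\<forall>p\<in>carrier A. \<forall>v\<in>tangent_space A p. \<gamma> 0 p v = v) \<and>
     0 < \<delta> \<and>
     (\<forall>r. \<bar>r\<bar> < \<delta> \<longrightarrow> (\<forall>p\<in>carrier A. bij_betw (\<gamma> r p) (tangent_space A p) (tangent_space A p)))"

definition family_deriv ::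
  "(real \<Rightarrow> 'm \<Rightarrow> 'm tvec \<Rightarrow> 'm tvec) \<Rightarrow> real \<Rightarrow> 'm \<Rightarrow> 'm tvec \<Rightarrow> 'm tvec" where
  "family_deriv \<gamma> r p v = (\<lambda>f. deriv (\<lambda>s. \<gamma> s p v f) r)"

definition ambient_manifold ::
  "real \<Rightarrow> ('m, 'e) chart set \<Rightarrow> (real \<times> real \<times> 'm, real \<times> real \<times> 'e) chart set" where
  "ambient_manifold \<delta> A = open_times {0<..} (open_times {-\<delta><..<\<delta>} A)"

text \<open>The differential of a function \<open>h\<close> is evaluated on a tangent vector \<open>v\<close> as \<open>v h\<close>.\<close>

definition ambient_metric ::
  "('m::topological_space, 'e::euclidean_space) chart set \<Rightarrow> 'm metric_tensor \<Rightarrow>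
   (real \<Rightarrow> 'm \<Rightarrow> 'm tvec \<Rightarrow> 'm tvec) \<Rightarrow> (real \<times> real \<times> 'm) metric_tensor" where
  "ambient_metric A g \<gamma> =
     (\<lambda>(t, r, x) v w.
        let drt = (\<lambda>u. u (\<lambda>(t, r, x). r * t));
            dt = (\<lambda>u. u (\<lambda>(t, r, x). t));
            pr = tmap A (\<lambda>(t, r, x). x) (t, r, x)
        in drt v * dt w + dt v * drt w + t\<^sup>2 * g x (\<gamma> r x (pr v)) (pr w))"

definition Psi :: "'m \<Rightarrow> real \<times> real \<times> 'm" where
  "Psi x = (1, 0, x)"

definition xi_field ::
  "('m::topological_space, 'e::euclidean_space) chart set \<Rightarrow> real \<Rightarrow> 'm \<Rightarrow> (real \<times> real \<times> 'm) tvec"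
  where
  "xi_field A \<delta> x =
     (\<lambda>f. if smooth_near (ambient_manifold \<delta> A) (Psi x) f then deriv (\<lambda>t. f (t, 0, x)) 1 else 0)"


section \<open>The tractor bundle\<close>

text \<open>A vector bundle over \<open>'m\<close> with fibres consisting of tangent vectors of \<open>'n\<close>, with its smooth
  sections, a line subbundle, a bundle metric and a linear connection.\<close>

record ('m, 'n) tractor_bundle =
  fibre :: "'m \<Rightarrow> 'n tvec set"
  sections :: "('m \<Rightarrow> 'n tvec) set"
  line :: "'m \<Rightarrow> 'n tvec set"
  bmetric :: "'m \<Rightarrow> 'n tvec \<Rightarrow> 'n tvec \<Rightarrow> real"
  bconn :: "('m, 'n) connection"

text \<open>The bundle associated with a map \<open>F\<close> into \<open>(B, G)\<close> and a field \<open>\<xi>\<close> along \<open>F\<close>, where \<open>D\<close> is the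
  pullback of the Levi-Civita connection of \<open>G\<close>.\<close>

definition associated_tractor_bundle ::
  "('m::topological_space, 'e::euclidean_space) chart set \<Rightarrow>
   ('n::topological_space, 'f::euclidean_space) chart set \<Rightarrow> 'n metric_tensor \<Rightarrow>
   ('m \<Rightarrow> 'n) \<Rightarrow> ('m \<Rightarrow> 'n tvec) \<Rightarrow> ('m, 'n) connection \<Rightarrow> ('m, 'n) tractor_bundle" where
  "associated_tractor_bundle A B G F \<xi> D =
     \<lparr>fibre = (\<lambda>x. tangent_space B (F x)),
      sections = fields_along A B F (carrier A),
      line = (\<lambda>x. {a *\<^sub>T \<xi> x |a. True}),
      bmetric = (\<lambda>x. G (F x)),
      bconn = D\<rparr>"

definition parallel_section ::
  "('m::topological_space, 'e::euclidean_space) chart set \<Rightarrow> ('m, 'n) tractor_bundle \<Rightarrow>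
   ('m \<Rightarrow> 'n tvec) \<Rightarrow> bool" where
  "parallel_section A T W \<longleftrightarrow> W \<in> sections T \<and>
     (\<forall>V\<in>\<XX> A. \<forall>x\<in>carrier A. bconn T x (V x) W = 0)"


section \<open>Submanifold geometry\<close>

text \<open>Tangent and normal part of a vector field along an immersion \<open>F\<close> of \<open>A\<close> into \<open>(B, G)\<close>; the tangent
  part is regarded as a vector field on \<open>A\<close>.\<close>

definition tangent_part ::
  "('m::topological_space, 'e::euclidean_space) chart set \<Rightarrow>
   ('n::topological_space, 'f::euclidean_space) chart set \<Rightarrow> 'n metric_tensor \<Rightarrow>
   ('m \<Rightarrow> 'n) \<Rightarrow> ('m \<Rightarrow> 'n tvec) \<Rightarrow> 'm \<Rightarrow> 'm tvec" where
  "tangent_part A B G F W x =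
     (THE u. u \<in> tangent_space A x \<and>
        (\<forall>w\<in>tangent_space A x. G (F x) (W x - tmap B F x u) (tmap B F x w) = 0))"

definition normal_part ::
  "('m::topological_space, 'e::euclidean_space) chart set \<Rightarrow>
   ('n::topological_space, 'f::euclidean_space) chart set \<Rightarrow> 'n metric_tensor \<Rightarrow>
   ('m \<Rightarrow> 'n) \<Rightarrow> ('m \<Rightarrow> 'n tvec) \<Rightarrow> 'm \<Rightarrow> 'n tvec" where
  "normal_part A B G F W x = W x - tmap B F x (tangent_part A B G F W x)"

text \<open>In the next three definitions \<open>D\<close> is the pullback under \<open>F\<close> of the Levi-Civita connection of
  \<open>G\<close>.\<close>

definition second_fundamental_form ::
  "('m::topological_space, 'e::euclidean_space) chart set \<Rightarrow>
   ('n::topological_space, 'f::euclidean_space) chart set \<Rightarrow> 'n metric_tensor \<Rightarrow>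
   ('m \<Rightarrow> 'n) \<Rightarrow> ('m, 'n) connection \<Rightarrow> ('m \<Rightarrow> 'm tvec) \<Rightarrow> ('m \<Rightarrow> 'm tvec) \<Rightarrow> 'm \<Rightarrow> 'n tvec" where
  "second_fundamental_form A B G F D V Z =
     normal_part A B G F (\<lambda>x. D x (V x) (\<lambda>q. tmap B F q (Z q)))"

definition weingarten ::
  "('m::topological_space, 'e::euclidean_space) chart set \<Rightarrow>
   ('n::topological_space, 'f::euclidean_space) chart set \<Rightarrow> 'n metric_tensor \<Rightarrow>
   ('m \<Rightarrow> 'n) \<Rightarrow> ('m, 'n) connection \<Rightarrow> ('m \<Rightarrow> 'n tvec) \<Rightarrow> ('m \<Rightarrow> 'm tvec) \<Rightarrow> 'm \<Rightarrow> 'm tvec" where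
  "weingarten A B G F D \<zeta> V =
     (\<lambda>x. - tangent_part A B G F (\<lambda>q. D q (V q) \<zeta>) x)"

definition normal_connection ::
  "('m::topological_space, 'e::euclidean_space) chart set \<Rightarrow>
   ('n::topological_space, 'f::euclidean_space) chart set \<Rightarrow> 'n metric_tensor \<Rightarrow>
   ('m \<Rightarrow> 'n) \<Rightarrow> ('m, 'n) connection \<Rightarrow> ('m \<Rightarrow> 'm tvec) \<Rightarrow> ('m \<Rightarrow> 'n tvec) \<Rightarrow> 'm \<Rightarrow> 'n tvec" where
  "normal_connection A B G F D V \<zeta> =
     normal_part A B G F (\<lambda>x. D x (V x) \<zeta>)"

end

theory Submission
  imports Defs "HOL-Computational_Algebra.Polynomial"
begin

text \<open>Write \<open>D\<close> for the pulled back connection and split a section as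
  \<open>W = T\<Psi> W\<^sup>\<top> + W\<^sup>\<bottom>\<close>. Additivity of \<open>D\<close> gives
  \<open>D V W = D V (T\<Psi> W\<^sup>\<top>) + D V W\<^sup>\<bottom>\<close>. The tangential part of the first summand is \<open>\<nabla> V W\<^sup>\<top>\<close> (the
  Gauss formula) and its normal part is \<open>II(V, W\<^sup>\<top>)\<close>; the second summand has tangential part
  \<open>- A V\<close> with respect to \<open>W\<^sup>\<bottom>\<close>, and its normal part is the normal derivative of \<open>W\<^sup>\<bottom>\<close>. A vector along
  \<open>\<Psi>\<close> vanishes iff its tangential and its normal part do, which is the claim (\<open>parallel_iff\<close>).

  What needs proof is that the two parts of a smooth section are smooth, and the Gauss formula. For
  \<open>\<Psi> x = (1, 0, x)\<close> the tangential part of a vector is its image under the differential of the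
  projection \<open>(t, r, x) \<mapsto> x\<close> (\<open>tangent_part_eq\<close>), whence smoothness.

  A vector field \<open>Y\<close> on \<open>M\<close> lifts to the ambient field that restricts to \<open>Y\<close> on every slice
  \<open>{t} \<times> {r} \<times> M\<close>. The lift extends \<open>T\<Psi> Y\<close>, so that \<open>D V (T\<Psi> Y)\<close> is an ambient covariant derivative
  of lifts. The ambient metric takes the value \<open>t\<^sup>2 g(\<gamma>(r) Y, Z)\<close> on two lifts, which is smooth and
  restricts to \<open>g(Y, Z)\<close> along \<open>\<Psi>\<close>, and the bracket of two lifts projects to the bracket. Hence the
  tangential part \<open>P X Y\<close> of the ambient derivative satisfies, at a point of \<open>M\<close>, the metricity and
  torsion identities of the Levi-Civita connection. The difference \<open>P X Y - \<nabla> X Y\<close> is therefore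
  symmetric in \<open>X, Y\<close>, while its product with \<open>Z\<close> is skew in \<open>Y, Z\<close>; such an expression vanishes for
  all fields \<open>Z\<close>. Since a tangent vector at a point extends to a global vector field
  (\<open>tangent_extends\<close>, by means of a bump function), the difference itself vanishes
  (\<open>gauss_formula\<close>).

  Smoothness is handled through germs: a function on a manifold is smooth near a point iff its
  expression in one, equivalently in every, chart is smooth there (\<open>smooth_near_iff\<close>), and vector
  fields are characterised by their action on such germs (\<open>fields_along_iff\<close>).\<close>


section \<open>Calculus of \<open>C\<^sup>\<infinity>\<close> functions on Euclidean spaces\<close>

lemma frechet_derivative_cong_open:
  assumes "open S" "x \<in> S" "\<And>y. y \<in> S \<Longrightarrow> f y = g y"
  shows "frechet_derivative f (at x) = frechet_derivative g (at x)"
proof -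
  have "(f has_derivative F) (at x) \<longleftrightarrow> (g has_derivative F) (at x)" for F
    using has_derivative_transform_within_open[of f F x UNIV S g]
      has_derivative_transform_within_open[of g F x UNIV S f] assms by auto
  then show ?thesis unfolding frechet_derivative_def by simp
qed

lemma differentiable_cong_open:
  assumes "open S" "x \<in> S" "\<And>y. y \<in> S \<Longrightarrow> f y = g y" "f differentiable (at x)"
  shows "g differentiable (at x)"
  using assms has_derivative_transform_within_open[of f _ x UNIV S g]
  unfolding differentiable_def by metis

lemma Ck_cong:
  assumes "open S" "\<And>y. y \<in> S \<Longrightarrow> f y = g y" "Ck k S f"
  shows "Ck k S g"
  using assms(2,3)
proof (induction k arbitrary: f g)
  case 0
  then show ?case by (simp cong: continuous_on_cong)
next
  case (Suc k)
  have "frechet_derivative f (at x) = frechet_derivative g (at x)" if "x \<in> S" for x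
    using frechet_derivative_cong_open[OF assms(1) that] Suc.prems(1) by blast
  then have "Ck k S (\<lambda>x. frechet_derivative g (at x) v)" for v
    using Suc.IH[of "\<lambda>x. frechet_derivative f (at x) v" "\<lambda>x. frechet_derivative g (at x) v"]
      Suc.prems(2) by simp
  then show ?case
    using Suc.prems differentiable_cong_open[OF assms(1)] by (metis Ck.simps(2))
qed

lemma Ck_subset: "Ck k S f \<Longrightarrow> T \<subseteq> S \<Longrightarrow> Ck k T f"
  by (induction k arbitrary: f) (auto intro: continuous_on_subset)

lemma Ck_Suc_imp_Ck: "Ck (Suc k) S f \<Longrightarrow> Ck k S f"
proof (induction k arbitrary: f)
  case 0
  then show ?case
    using differentiable_imp_continuous_within[of f _ UNIV]
    by (auto intro!: continuous_at_imp_continuous_on)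
next
  case (Suc k)
  then show ?case by (metis Ck.simps(2))
qed

lemma Ck_SucI:
  assumes "open S" "\<And>x. x \<in> S \<Longrightarrow> (f has_derivative f' x) (at x)"
    and "\<And>v. Ck k S (\<lambda>x. f' x v)"
  shows "Ck (Suc k) S f"
proof -
  have "frechet_derivative f (at x) = f' x" if "x \<in> S" for x
    using frechet_derivative_at[OF assms(2)[OF that]] by simp
  then have "Ck k S (\<lambda>x. frechet_derivative f (at x) v)" for v
    using Ck_cong[OF assms(1) _ assms(3)[of v]] by simp
  then show ?thesis using assms(2) by (auto simp: differentiable_def)
qed

lemma Ck_const: "open S \<Longrightarrow> Ck k S (\<lambda>x. c)"
proof (induction k arbitrary: c)
  case (Suc k)
  then show ?case by (intro Ck_SucI[where f' = "\<lambda>x v. 0"]) auto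
qed simp

lemma Ck_bounded_linear:
  assumes "open S" "bounded_linear L" "Ck k S f"
  shows "Ck k S (\<lambda>x. L (f x))"
  using assms(3)
proof (induction k arbitrary: f)
  case 0
  then show ?case using bounded_linear.continuous_on[OF assms(2)] by simp
next
  case (Suc k)
  show ?case
  proof (rule Ck_SucI[OF assms(1)])
    show "((\<lambda>x. L (f x)) has_derivative (\<lambda>v. L (frechet_derivative f (at x) v))) (at x)"
      if "x \<in> S" for x
      using Suc.prems that
      by (intro bounded_linear.has_derivative[OF assms(2)]) (simp flip: frechet_derivative_works)
    show "Ck k S (\<lambda>x. L (frechet_derivative f (at x) v))" for v
      using Suc by simp
  qed
qed

lemma Ck_ident: "open S \<Longrightarrow> Ck k S (\<lambda>x. x)"
proof (induction k)
  case (Suc k)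
  then show ?case by (intro Ck_SucI[where f' = "\<lambda>x v. v"]) (auto intro: Ck_const)
qed simp

lemma Ck_add:
  assumes "open S" "Ck k S f" "Ck k S g"
  shows "Ck k S (\<lambda>x. f x + g x)"
  using assms(2,3)
proof (induction k arbitrary: f g)
  case 0
  then show ?case by (simp add: continuous_on_add)
next
  case (Suc k)
  show ?case
  proof (rule Ck_SucI[OF assms(1)])
    show "((\<lambda>x. f x + g x) has_derivative
        (\<lambda>v. frechet_derivative f (at x) v + frechet_derivative g (at x) v)) (at x)"
      if "x \<in> S" for x
      using Suc.prems that by (auto intro!: has_derivative_add simp flip: frechet_derivative_works)
    show "Ck k S (\<lambda>x. frechet_derivative f (at x) v + frechet_derivative g (at x) v)" for v
      using Suc by simp
  qed
qed

lemma Ck_sum: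
  assumes "open S" "\<And>i. i \<in> I \<Longrightarrow> Ck k S (f i)"
  shows "Ck k S (\<lambda>x. \<Sum>i\<in>I. f i x)"
  using assms(2)
  by (induction I rule: infinite_finite_induct) (auto intro: Ck_const Ck_add assms(1))

lemma Ck_bilinear:
  assumes "open S" "bounded_bilinear B" "Ck k S f" "Ck k S g"
  shows "Ck k S (\<lambda>x. B (f x) (g x))"
  using assms(3,4)
proof (induction k arbitrary: f g)
  case 0
  then show ?case using bounded_bilinear.continuous_on[OF assms(2)] by simp
next
  case (Suc k)
  show ?case
  proof (rule Ck_SucI[OF assms(1)])
    show "((\<lambda>x. B (f x) (g x)) has_derivative
        (\<lambda>v. B (f x) (frechet_derivative g (at x) v) + B (frechet_derivative f (at x) v) (g x))) (at x)"
      if "x \<in> S" for x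
      using Suc.prems that
      by (intro bounded_bilinear.FDERIV[OF assms(2)]) (simp_all flip: frechet_derivative_works)
    show "Ck k S (\<lambda>x. B (f x) (frechet_derivative g (at x) v) + B (frechet_derivative f (at x) v) (g x))" for v
    proof (rule Ck_add[OF assms(1)])
      show "Ck k S (\<lambda>x. B (f x) (frechet_derivative g (at x) v))"
        using Suc.IH[OF Ck_Suc_imp_Ck[OF Suc.prems(1)]] Suc.prems(2) by simp
      show "Ck k S (\<lambda>x. B (frechet_derivative f (at x) v) (g x))"
        using Suc.IH[OF _ Ck_Suc_imp_Ck[OF Suc.prems(2)]] Suc.prems(1) by simp
    qed
  qed
qed

lemma linear_eq_sum_Basis:
  fixes L :: "'a::euclidean_space \<Rightarrow> 'b::real_normed_vector"
  assumes "linear L"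
  shows "L v = (\<Sum>b\<in>Basis. (v \<bullet> b) *\<^sub>R L b)"
proof -
  have "L v = L (\<Sum>b\<in>Basis. (v \<bullet> b) *\<^sub>R b)" by (simp add: euclidean_representation)
  then show ?thesis by (simp add: linear_sum[OF assms] linear_scale[OF assms])
qed

lemma frechet_derivative_eq_sum_Basis:
  fixes f :: "'a::euclidean_space \<Rightarrow> 'b::real_normed_vector"
  assumes "f differentiable (at x)"
  shows "frechet_derivative f (at x) v = (\<Sum>b\<in>Basis. (v \<bullet> b) *\<^sub>R frechet_derivative f (at x) b)"
  using linear_eq_sum_Basis[OF linear_frechet_derivative[OF assms]] .

text \<open>The chain rule is not of the form covered by the lemma on bilinear maps. Expanding the inner
  derivative in the standard basis turns it into a sum of products of a coordinate of \<open>h' x v\<close> with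
  the composition of a partial derivative of \<open>f\<close> with \<open>h\<close>, to which the induction hypothesis
  applies.\<close>

lemma Ck_compose:
  fixes h :: "'a::real_normed_vector \<Rightarrow> 'b::euclidean_space"
  assumes "open S" "open T" "h ` S \<subseteq> T" "Ck k S h" "Ck k T f"
  shows "Ck k S (\<lambda>x. f (h x))"
  using assms(4,5)
proof (induction k arbitrary: f)
  case 0
  then show ?case using assms(3) by (auto intro: continuous_on_compose2)
next
  case (Suc k)
  define f' where "f' x = frechet_derivative f (at x)" for x
  define h' where "h' x = frechet_derivative h (at x)" for x
  have f': "(f has_derivative f' x) (at x)" if "x \<in> T" for x
    using that Suc.prems by (simp add: f'_def flip: frechet_derivative_works)
  have h': "(h has_derivative h' x) (at x)" if "x \<in> S" for x
    using that Suc.prems by (simp add: h'_def flip: frechet_derivative_works)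
  show ?case
  proof (rule Ck_SucI[OF assms(1)])
    fix x assume x: "x \<in> S"
    then have "h x \<in> T" using assms(3) by auto
    have "((\<lambda>x. f (h x)) has_derivative (\<lambda>v. f' (h x) (h' x v))) (at x)"
      using has_derivative_compose[OF h'[OF x] f'[OF \<open>h x \<in> T\<close>]] .
    moreover have "f' (h x) (h' x v) = (\<Sum>b\<in>Basis. (h' x v \<bullet> b) *\<^sub>R f' (h x) b)" for v
      using linear_eq_sum_Basis has_derivative_linear[OF f'[OF \<open>h x \<in> T\<close>]] by blast
    ultimately show "((\<lambda>x. f (h x)) has_derivative
        (\<lambda>v. \<Sum>b\<in>Basis. (h' x v \<bullet> b) *\<^sub>R f' (h x) b)) (at x)" by simp
  next
    fix v
    show "Ck k S (\<lambda>x. \<Sum>b\<in>Basis. (h' x v \<bullet> b) *\<^sub>R f' (h x) b)"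
    proof (rule Ck_sum[OF assms(1)], rule Ck_bilinear[OF assms(1) bounded_bilinear_scaleR])
      fix b :: 'b
      show "Ck k S (\<lambda>x. h' x v \<bullet> b)"
        using Suc.prems(1)
        by (intro Ck_bounded_linear[OF assms(1) bounded_linear_inner_left]) (simp add: h'_def)
      have "Ck k T (\<lambda>x. f' x b)" using Suc.prems by (simp add: f'_def)
      then show "Ck k S (\<lambda>x. f' (h x) b)"
        using Suc.IH Ck_Suc_imp_Ck[OF Suc.prems(1)] by blast
    qed
  qed
qed

text \<open>The germ version of \<^const>\<open>C_infinity\<close>.\<close>

definition smooth_at :: "'a::real_normed_vector \<Rightarrow> ('a \<Rightarrow> 'b::real_normed_vector) \<Rightarrow> bool" where
  "smooth_at z f \<longleftrightarrow> (\<exists>S. open S \<and> z \<in> S \<and> C_infinity S f)"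

lemma C_infinity_imp_smooth_at: "open S \<Longrightarrow> z \<in> S \<Longrightarrow> C_infinity S f \<Longrightarrow> smooth_at z f"
  unfolding smooth_at_def by blast

lemma smooth_at_imp_C_infinity:
  assumes "\<And>z. z \<in> S \<Longrightarrow> smooth_at z f"
  shows "C_infinity S f"
proof -
  have "\<forall>z\<in>S. \<exists>T. open T \<and> z \<in> T \<and> Ck k T f" for k
    using assms unfolding smooth_at_def C_infinity_def by fast
  moreover have "\<forall>z\<in>S. \<exists>T. open T \<and> z \<in> T \<and> Ck k T f \<Longrightarrow> Ck k S f" for k
  proof (induction k arbitrary: f)
    case 0
    then show ?case
      by (metis Ck.simps(1) continuous_at_imp_continuous_on continuous_on_eq_continuous_at)
  next
    case (Suc k)
    have "\<forall>z\<in>S. f differentiable (at z)" using Suc.prems by auto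
    moreover have "Ck k S (\<lambda>x. frechet_derivative f (at x) v)" for v
      using Suc.prems by (intro Suc.IH) (metis Ck.simps(2))
    ultimately show ?case by simp
  qed
  ultimately show ?thesis unfolding C_infinity_def by blast
qed

lemma smooth_at_open:
  assumes "smooth_at z f"
  obtains S where "open S" "z \<in> S" "\<And>y. y \<in> S \<Longrightarrow> smooth_at y f"
proof -
  obtain S where "open S" "z \<in> S" "C_infinity S f" using assms unfolding smooth_at_def by blast
  then show ?thesis using that[of S] C_infinity_imp_smooth_at[of S _ f] by simp
qed

lemma smooth_at_cong:
  assumes "smooth_at z f" "open S" "z \<in> S" "\<And>y. y \<in> S \<Longrightarrow> f y = g y"
  shows "smooth_at z g"
proof -
  obtain T where T: "open T" "z \<in> T" "\<forall>k. Ck k T f"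
    using assms(1) unfolding smooth_at_def C_infinity_def by blast
  have "Ck k (S \<inter> T) g" for k
    using Ck_cong[of "S \<inter> T" f g k] T assms Ck_subset[of k T f "S \<inter> T"] by auto
  then show ?thesis
    unfolding smooth_at_def C_infinity_def using T assms by (intro exI[of _ "S \<inter> T"]) auto
qed

lemma C_infinity_differentiable: "C_infinity S f \<Longrightarrow> z \<in> S \<Longrightarrow> f differentiable (at z)"
  unfolding C_infinity_def by (drule spec[of _ "Suc 0"]) simp

lemma C_infinity_frechet_derivative:
  "C_infinity S f \<Longrightarrow> C_infinity S (\<lambda>x. frechet_derivative f (at x) v)"
  unfolding C_infinity_def
proof
  fix k assume "\<forall>k. Ck k S f"
  then have "Ck (Suc k) S f" by blast
  then show "Ck k S (\<lambda>x. frechet_derivative f (at x) v)" by simp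
qed

lemma smooth_at_differentiable: "smooth_at z f \<Longrightarrow> f differentiable (at z)"
  unfolding smooth_at_def using C_infinity_differentiable by blast

lemma smooth_at_frechet_derivative:
  "smooth_at z f \<Longrightarrow> smooth_at z (\<lambda>x. frechet_derivative f (at x) v)"
  unfolding smooth_at_def using C_infinity_frechet_derivative by blast

lemma smooth_at_const: "smooth_at z (\<lambda>x. c)"
  unfolding smooth_at_def C_infinity_def using Ck_const open_UNIV by blast

lemma smooth_at_ident: "smooth_at z (\<lambda>x. x)"
  unfolding smooth_at_def C_infinity_def using Ck_ident open_UNIV by blast

lemma smooth_at_bounded_linear: "bounded_linear L \<Longrightarrow> smooth_at z f \<Longrightarrow> smooth_at z (\<lambda>x. L (f x))"
  unfolding smooth_at_def C_infinity_def using Ck_bounded_linear by blast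

lemma smooth_at_common:
  assumes "smooth_at z f" "smooth_at z g"
  obtains S where "open S" "z \<in> S" "\<And>k. Ck k S f" "\<And>k. Ck k S g"
proof -
  obtain S where S: "open S" "z \<in> S" "\<forall>k. Ck k S f"
    using assms(1) unfolding smooth_at_def C_infinity_def by blast
  obtain T where T: "open T" "z \<in> T" "\<forall>k. Ck k T g"
    using assms(2) unfolding smooth_at_def C_infinity_def by blast
  show ?thesis
  proof (rule that[of "S \<inter> T"])
    show "open (S \<inter> T)" "z \<in> S \<inter> T" using S T by auto
    show "Ck k (S \<inter> T) f" for k using S(3) Ck_subset[of k S f] by simp
    show "Ck k (S \<inter> T) g" for k using T(3) Ck_subset[of k T g] by simp
  qed
qed

lemma smooth_at_linear: "bounded_linear L \<Longrightarrow> smooth_at z L"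
  using smooth_at_bounded_linear[OF _ smooth_at_ident] by blast

lemma smooth_at_bilinear:
  assumes "bounded_bilinear B" "smooth_at z f" "smooth_at z g"
  shows "smooth_at z (\<lambda>x. B (f x) (g x))"
proof -
  obtain S where "open S" "z \<in> S" "\<And>k. Ck k S f" "\<And>k. Ck k S g"
    using smooth_at_common[OF assms(2,3)] by blast
  then show ?thesis
    unfolding smooth_at_def C_infinity_def by (intro exI[of _ S]) (simp add: Ck_bilinear[OF _ assms(1)])
qed

lemma smooth_at_add:
  assumes "smooth_at z f" "smooth_at z g"
  shows "smooth_at z (\<lambda>x. f x + g x)"
proof -
  obtain S where "open S" "z \<in> S" "\<And>k. Ck k S f" "\<And>k. Ck k S g"
    using smooth_at_common[OF assms] by blast
  then show ?thesis
    unfolding smooth_at_def C_infinity_def by (intro exI[of _ S]) (simp add: Ck_add)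
qed

lemma smooth_at_Pair:
  assumes "smooth_at z f" "smooth_at z g"
  shows "smooth_at z (\<lambda>x. (f x, g x))"
proof -
  have "smooth_at z (\<lambda>x. (f x, 0) + (0, g x))"
    by (intro smooth_at_add smooth_at_bounded_linear[of "\<lambda>y. (y, 0)"]
        smooth_at_bounded_linear[of "\<lambda>y. (0, y)"] assms bounded_linear_Pair
        bounded_linear_ident bounded_linear_zero)
  then show ?thesis by simp
qed

lemma smooth_at_compose:
  fixes h :: "'a::real_normed_vector \<Rightarrow> 'b::euclidean_space"
  assumes "smooth_at z h" "smooth_at (h z) f"
  shows "smooth_at z (\<lambda>x. f (h x))"
proof -
  obtain S where S: "open S" "z \<in> S" "\<forall>k. Ck k S h"
    using assms(1) unfolding smooth_at_def C_infinity_def by blast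
  obtain T where T: "open T" "h z \<in> T" "\<forall>k. Ck k T f"
    using assms(2) unfolding smooth_at_def C_infinity_def by blast
  have "continuous_on S h" using S(3)[THEN spec, of 0] by simp
  then have *: "open (S \<inter> h -` T)" using S(1) T(1) by (simp add: continuous_open_preimage)
  have "Ck k (S \<inter> h -` T) (\<lambda>x. f (h x))" for k
    using Ck_compose[OF * T(1), of h k f] Ck_subset[of k S h "S \<inter> h -` T"] S(3) T(3) by auto
  then show ?thesis
    unfolding smooth_at_def C_infinity_def using * S T by (intro exI[of _ "S \<inter> h -` T"]) auto
qed


section \<open>A smooth bump function\<close>

text \<open>For a polynomial \<open>p\<close>, the function \<open>p (1 / x) * exp (- 1 / x)\<close> on the positive half-line,
  extended by zero. The class of these functions is closed under differentiation.\<close>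

definition flat_exp :: "real poly \<Rightarrow> real \<Rightarrow> real" where
  "flat_exp p x = (if x > 0 then poly p (1 / x) * exp (- 1 / x) else 0)"

lemma poly_times_exp_minus_tendsto_0: "((\<lambda>y::real. poly p y * exp (- y)) \<longlongrightarrow> 0) at_top"
proof -
  have "((\<lambda>y::real. \<Sum>i\<le>degree p. coeff p i * (y ^ i / exp y)) \<longlongrightarrow> (\<Sum>i\<le>degree p. coeff p i * 0)) at_top"
    by (intro tendsto_intros tendsto_power_div_exp_0)
  moreover have "(\<lambda>y::real. \<Sum>i\<le>degree p. coeff p i * (y ^ i / exp y)) = (\<lambda>y. poly p y * exp (- y))"
    by (simp add: poly_altdef sum_distrib_right exp_minus divide_inverse mult.assoc)
  ultimately show ?thesis by simp
qed

lemma flat_exp_tendsto_0: "(flat_exp p \<longlongrightarrow> 0) (at 0)"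
proof -
  have "(flat_exp p \<longlongrightarrow> 0) (at_right 0)"
  proof (rule Lim_transform_eventually)
    show "((\<lambda>x. poly p (inverse x) * exp (- (inverse x))) \<longlongrightarrow> 0) (at_right 0)"
      using filterlim_compose[OF poly_times_exp_minus_tendsto_0 filterlim_inverse_at_top_right] .
    show "\<forall>\<^sub>F x in at_right 0. poly p (inverse x) * exp (- inverse x) = flat_exp p x"
      by (auto simp: flat_exp_def eventually_at_filter inverse_eq_divide)
  qed
  moreover have "(flat_exp p \<longlongrightarrow> 0) (at_left 0)"
    by (rule Lim_transform_eventually[OF tendsto_const])
      (auto simp: flat_exp_def eventually_at_filter)
  ultimately show ?thesis by (simp add: filterlim_split_at)
qed

lemma flat_exp_has_derivative:
  "(flat_exp p has_real_derivative flat_exp ([:0, 0, 1:] * (p - pderiv p)) x) (at x)"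
proof -
  consider "x > 0" | "x < 0" | "x = 0" by linarith
  then show ?thesis
  proof cases
    case 1
    have "((\<lambda>x. poly p (1 / x) * exp (- 1 / x)) has_real_derivative
        flat_exp ([:0, 0, 1:] * (p - pderiv p)) x) (at x)"
      using 1 by (auto intro!: derivative_eq_intros DERIV_chain2[OF poly_DERIV]
          simp: flat_exp_def divide_simps power2_eq_square) (simp add: algebra_simps)
    then show ?thesis
      using 1 has_field_derivative_transform_within_open[of _ _ x "{0<..}" "flat_exp p"]
      by (auto simp: flat_exp_def)
  next
    case 2
    have "((\<lambda>x. 0) has_real_derivative 0) (at x)" by simp
    then have "(flat_exp p has_real_derivative 0) (at x)"
      using 2 has_field_derivative_transform_within_open[of "\<lambda>x. 0" 0 x "{..<0}" "flat_exp p"]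
      by (auto simp: flat_exp_def)
    then show ?thesis using 2 by (simp add: flat_exp_def)
  next
    case 3
    \<comment> \<open>The difference quotient at \<open>0\<close> is again a function of the class, for the polynomial
      \<open>y * p y\<close>.\<close>
    have "((\<lambda>h. (flat_exp p (0 + h) - flat_exp p 0) / h) \<longlongrightarrow> 0) (at 0)"
      using flat_exp_tendsto_0[of "[:0, 1:] * p"]
      by (rule Lim_transform_eventually) (auto simp: flat_exp_def eventually_at_filter)
    then show ?thesis using 3 by (simp add: DERIV_def flat_exp_def)
  qed
qed

lemma flat_exp_smooth_at: "smooth_at x (flat_exp p)"
proof -
  have "Ck k UNIV (flat_exp p)" for k
  proof (induction k arbitrary: p)
    case 0
    show ?case
      using DERIV_isCont[OF flat_exp_has_derivative]
      by (auto intro!: continuous_at_imp_continuous_on)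
  next
    case (Suc k)
    show ?case
    proof (rule Ck_SucI)
      show "(flat_exp p has_derivative (\<lambda>v. flat_exp ([:0, 0, 1:] * (p - pderiv p)) x * v)) (at x)" for x
        using flat_exp_has_derivative by (simp add: has_field_derivative_def)
      show "Ck k UNIV (\<lambda>x. flat_exp ([:0, 0, 1:] * (p - pderiv p)) x * v)" for v
        using Ck_bounded_linear[OF open_UNIV bounded_linear_mult_left Suc.IH] .
    qed simp
  qed
  then show ?thesis unfolding smooth_at_def C_infinity_def by blast
qed

lemma smooth_bump:
  fixes z :: "'a::euclidean_space"
  assumes "e > 0"
  shows "\<exists>b :: 'a \<Rightarrow> real. (\<forall>y. smooth_at y b) \<and> b z = 1 \<and> (\<forall>y. e \<le> dist z y \<longrightarrow> b y = 0)"
proof (intro exI conjI allI impI)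
  \<comment> \<open>\<open>?q\<close> is positive exactly on the ball of radius \<open>e\<close> around \<open>z\<close>; the factor normalises the
    value at \<open>z\<close>.\<close>
  let ?q = "\<lambda>y. e\<^sup>2 + - ((y - z) \<bullet> (y - z))"
  define b where "b y = flat_exp 1 (?q y) * inverse (flat_exp 1 (e\<^sup>2))" for y :: 'a
  have id: "smooth_at y (\<lambda>y. y - z)" for y
    using smooth_at_add[OF smooth_at_ident smooth_at_const[of y "- z"]] by simp
  have "smooth_at y ?q" for y
    by (intro smooth_at_add smooth_at_const smooth_at_bounded_linear[of uminus]
        smooth_at_bilinear[OF bounded_bilinear_inner] id bounded_linear_minus bounded_linear_ident)
  then show "smooth_at y b" for y
    unfolding b_def
    by (intro smooth_at_bilinear[OF bounded_bilinear_mult] smooth_at_const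
        smooth_at_compose[OF _ flat_exp_smooth_at])
  show "b z = 1" using assms by (simp add: b_def flat_exp_def)
  show "b y = 0" if "e \<le> dist z y" for y
  proof -
    have "e\<^sup>2 \<le> (norm (y - z))\<^sup>2"
      using that assms by (intro power_mono) (auto simp: dist_norm norm_minus_commute)
    then show ?thesis by (simp add: b_def flat_exp_def power2_norm_eq_inner)
  qed
qed


section \<open>Germs of smooth functions on a manifold\<close>

lemma chart_facts:
  assumes "smooth_manifold A" "(D, \<phi>) \<in> A"
  shows "open D" "open (\<phi> ` D)" "continuous_on D \<phi>" "continuous_on (\<phi> ` D) (inv_into D \<phi>)"
    "\<And>x. x \<in> D \<Longrightarrow> inv_into D \<phi> (\<phi> x) = x" "\<And>x. x \<in> D \<Longrightarrow> x \<in> carrier A"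
    "\<And>y. y \<in> \<phi> ` D \<Longrightarrow> \<phi> (inv_into D \<phi> y) = y"
proof -
  have *: "open D" "open (\<phi> ` D)" "homeomorphism D (\<phi> ` D) \<phi> (inv_into D \<phi>)"
    using assms unfolding smooth_manifold_def by auto
  then show "open D" "open (\<phi> ` D)" by auto
  show "continuous_on D \<phi>" "continuous_on (\<phi> ` D) (inv_into D \<phi>)"
    "\<And>x. x \<in> D \<Longrightarrow> inv_into D \<phi> (\<phi> x) = x"
    using *(3) unfolding homeomorphism_def by auto
  show "\<And>x. x \<in> D \<Longrightarrow> x \<in> carrier A"
    using assms(2) unfolding carrier_def by blast
  show "\<And>y. y \<in> \<phi> ` D \<Longrightarrow> \<phi> (inv_into D \<phi> y) = y" by (rule f_inv_into_f)
qed

lemma carrierE: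
  assumes "p \<in> carrier A"
  obtains D \<phi> where "(D, \<phi>) \<in> A" "p \<in> D"
  using assms unfolding carrier_def by blast

lemma open_carrier:
  assumes "smooth_manifold A"
  shows "open (carrier A)"
  unfolding carrier_def using chart_facts(1)[OF assms] by (intro open_UN) auto

lemma open_chart_image:
  assumes "smooth_manifold A" "(D, \<phi>) \<in> A" "open U"
  shows "open (\<phi> ` (U \<inter> D))"
proof -
  note c = chart_facts[OF assms(1,2)]
  have "\<phi> ` (U \<inter> D) = \<phi> ` D \<inter> inv_into D \<phi> -` U"
    using c(5) by (auto simp: c(7))
  then show ?thesis
    using continuous_open_preimage[OF c(4) c(2) assms(3)] by simp
qed

lemma open_chart_preimage:
  assumes "smooth_manifold A" "(D, \<phi>) \<in> A" "open S"
  shows "open (D \<inter> \<phi> -` S)"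
  using continuous_open_preimage[OF chart_facts(3,1)[OF assms(1,2)] assms(3)] .

lemma smooth_at_change_chart:
  assumes A: "smooth_manifold A" and D: "(D, \<phi>) \<in> A" and E: "(E, \<psi>) \<in> A"
    and p: "p \<in> D" "p \<in> E" and f: "smooth_at (\<phi> p) (f \<circ> inv_into D \<phi>)"
  shows "smooth_at (\<psi> p) (f \<circ> inv_into E \<psi>)"
proof -
  note cD = chart_facts[OF A D] and cE = chart_facts[OF A E]
  have O: "open (\<psi> ` (D \<inter> E))" using open_chart_image[OF A E cD(1)] .
  have "C_infinity (\<psi> ` (E \<inter> D)) (\<phi> \<circ> inv_into E \<psi>)"
    using A D E unfolding smooth_manifold_def by fast
  then have "smooth_at (\<psi> p) (\<phi> \<circ> inv_into E \<psi>)"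
    using O p by (intro C_infinity_imp_smooth_at[of "\<psi> ` (D \<inter> E)"]) (auto simp: Int_commute)
  moreover have "smooth_at ((\<phi> \<circ> inv_into E \<psi>) (\<psi> p)) (f \<circ> inv_into D \<phi>)"
    using f cE(5) p by simp
  ultimately have "smooth_at (\<psi> p) (\<lambda>y. (f \<circ> inv_into D \<phi>) ((\<phi> \<circ> inv_into E \<psi>) y))"
    by (rule smooth_at_compose)
  then show ?thesis
    by (rule smooth_at_cong[OF _ O]) (use p cD(5) cE(5) in auto)
qed

text \<open>Smoothness of a germ can be tested in a single chart, and in any chart.\<close>

lemma smooth_near_iff:
  assumes A: "smooth_manifold A" and D: "(D, \<phi>) \<in> A" and p: "p \<in> D"
  shows "smooth_near A p f \<longleftrightarrow> smooth_at (\<phi> p) (f \<circ> inv_into D \<phi>)"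
proof
  assume "smooth_near A p f"
  then obtain U where U: "open U" "p \<in> U" "smooth_fun A U f" unfolding smooth_near_def by blast
  then have "C_infinity (\<phi> ` (U \<inter> D)) (f \<circ> inv_into D \<phi>)"
    using D unfolding smooth_fun_def by fast
  then show "smooth_at (\<phi> p) (f \<circ> inv_into D \<phi>)"
    by (intro C_infinity_imp_smooth_at[OF open_chart_image[OF A D U(1)]]) (use U(2) p in auto)
next
  assume "smooth_at (\<phi> p) (f \<circ> inv_into D \<phi>)"
  then obtain S where S: "open S" "\<phi> p \<in> S" "\<And>y. y \<in> S \<Longrightarrow> smooth_at y (f \<circ> inv_into D \<phi>)"
    by (rule smooth_at_open) blast
  let ?U = "D \<inter> \<phi> -` S"
  have "smooth_fun A ?U f"
    unfolding smooth_fun_def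
  proof (safe, rule smooth_at_imp_C_infinity)
    fix E \<psi> y assume E: "(E, \<psi>) \<in> A" and "y \<in> \<psi> ` (?U \<inter> E)"
    then obtain q where q: "q \<in> D" "\<phi> q \<in> S" "q \<in> E" "y = \<psi> q" by auto
    show "smooth_at y (f \<circ> inv_into E \<psi>)"
      using smooth_at_change_chart[OF A D E q(1,3) S(3)[OF q(2)]] q(4) by simp
  qed
  then show "smooth_near A p f"
    unfolding smooth_near_def using open_chart_preimage[OF A D S(1)] S(2) p chart_facts(6)[OF A D]
    by (intro exI[of _ ?U]) auto
qed

lemma smooth_near_carrier: "smooth_near A p f \<Longrightarrow> p \<in> carrier A"
  unfolding smooth_near_def by blast

lemma smooth_fun_iff:
  assumes A: "smooth_manifold A" and U: "open U" "U \<subseteq> carrier A"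
  shows "smooth_fun A U f \<longleftrightarrow> (\<forall>p\<in>U. smooth_near A p f)"
proof
  assume "smooth_fun A U f"
  then show "\<forall>p\<in>U. smooth_near A p f" unfolding smooth_near_def using U by blast
next
  assume *: "\<forall>p\<in>U. smooth_near A p f"
  show "smooth_fun A U f"
    unfolding smooth_fun_def
  proof (safe, rule smooth_at_imp_C_infinity)
    fix E \<psi> y assume E: "(E, \<psi>) \<in> A" and "y \<in> \<psi> ` (U \<inter> E)"
    then show "smooth_at y (f \<circ> inv_into E \<psi>)" using * smooth_near_iff[OF A E] by auto
  qed
qed

lemma smooth_near_open:
  assumes "smooth_manifold A" "smooth_near A p f"
  obtains U where "open U" "p \<in> U" "U \<subseteq> carrier A" "\<And>q. q \<in> U \<Longrightarrow> smooth_near A q f"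
proof -
  obtain U where "open U" "p \<in> U" "U \<subseteq> carrier A" "smooth_fun A U f"
    using assms(2) unfolding smooth_near_def by blast
  then show ?thesis using that[of U] smooth_fun_iff[OF assms(1)] by simp
qed

lemma smooth_near_cong:
  assumes A: "smooth_manifold A" and f: "smooth_near A p f"
    and U: "open U" "p \<in> U" "\<And>q. q \<in> U \<Longrightarrow> f q = h q"
  shows "smooth_near A p h"
proof -
  obtain D \<phi> where D: "(D, \<phi>) \<in> A" "p \<in> D" using carrierE smooth_near_carrier[OF f] by metis
  have "smooth_at (\<phi> p) (h \<circ> inv_into D \<phi>)"
  proof (rule smooth_at_cong)
    show "smooth_at (\<phi> p) (f \<circ> inv_into D \<phi>)" using f smooth_near_iff[OF A D] by simp
    show "open (\<phi> ` (U \<inter> D))" using open_chart_image[OF A D(1) U(1)] .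
    show "\<phi> p \<in> \<phi> ` (U \<inter> D)" using U(2) D(2) by blast
    show "(f \<circ> inv_into D \<phi>) y = (h \<circ> inv_into D \<phi>) y" if "y \<in> \<phi> ` (U \<inter> D)" for y
      using that U(3) chart_facts(5)[OF A D(1)] by auto
  qed
  then show ?thesis using smooth_near_iff[OF A D] by simp
qed

lemma smooth_near_cong_iff:
  assumes "smooth_manifold A" "open U" "p \<in> U" "\<And>q. q \<in> U \<Longrightarrow> f q = h q"
  shows "smooth_near A p f \<longleftrightarrow> smooth_near A p h"
  using smooth_near_cong[OF assms(1) _ assms(2,3)] assms(4) by metis

lemma smooth_near_const: "smooth_manifold A \<Longrightarrow> p \<in> carrier A \<Longrightarrow> smooth_near A p (\<lambda>x. c)"
  by (erule carrierE) (simp add: smooth_near_iff comp_def smooth_at_const)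

lemma smooth_near_add:
  assumes "smooth_manifold A" "smooth_near A p f" "smooth_near A p h"
  shows "smooth_near A p (\<lambda>x. f x + h x)"
proof -
  obtain D \<phi> where D: "(D, \<phi>) \<in> A" "p \<in> D" using carrierE smooth_near_carrier[OF assms(2)] by metis
  then show ?thesis
    using assms smooth_at_add[of "\<phi> p" "f \<circ> inv_into D \<phi>" "h \<circ> inv_into D \<phi>"]
    by (simp add: smooth_near_iff comp_def)
qed

lemma smooth_near_mult:
  assumes "smooth_manifold A" "smooth_near A p f" "smooth_near A p h"
  shows "smooth_near A p (\<lambda>x. f x * h x)"
proof -
  obtain D \<phi> where D: "(D, \<phi>) \<in> A" "p \<in> D" using carrierE smooth_near_carrier[OF assms(2)] by metis
  then show ?thesis
    using assms smooth_at_bilinear[OF bounded_bilinear_mult, of "\<phi> p" "f \<circ> inv_into D \<phi>" "h \<circ> inv_into D \<phi>"]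
    by (simp add: smooth_near_iff comp_def)
qed

lemma smooth_near_sum:
  assumes "smooth_manifold A" "p \<in> carrier A" "\<And>i. i \<in> I \<Longrightarrow> smooth_near A p (f i)"
  shows "smooth_near A p (\<lambda>x. \<Sum>i\<in>I. f i x)"
  using assms(3)
  by (induction I rule: infinite_finite_induct)
    (auto intro: smooth_near_const smooth_near_add assms(1,2))

lemma smooth_near_coordinate:
  assumes A: "smooth_manifold A" and D: "(D, \<phi>) \<in> A" "p \<in> D"
  shows "smooth_near A p (\<lambda>x. \<phi> x \<bullet> i)"
proof -
  note c = chart_facts[OF A D(1)]
  have "smooth_at (\<phi> p) (\<lambda>y. y \<bullet> i)"
    by (rule smooth_at_linear[OF bounded_linear_inner_left])
  then have "smooth_at (\<phi> p) ((\<lambda>x. \<phi> x \<bullet> i) \<circ> inv_into D \<phi>)"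
    by (rule smooth_at_cong[OF _ c(2)]) (use D in \<open>auto simp: c(7)\<close>)
  then show ?thesis using smooth_near_iff[OF A D] by simp
qed


section \<open>Smooth maps and tangent vectors\<close>

text \<open>\<open>F\<close> is smooth at the point \<open>p\<close>: it is continuous there and its local representations are
  smooth near the image of \<open>p\<close> in the chart.\<close>

definition smooth_map_at ::
  "('m::t2_space, 'e::real_normed_vector) chart set \<Rightarrow>
   ('n::topological_space, 'f::real_normed_vector) chart set \<Rightarrow> ('m \<Rightarrow> 'n) \<Rightarrow> 'm \<Rightarrow> bool" where
  "smooth_map_at A B F p \<longleftrightarrow> p \<in> carrier A \<and> F p \<in> carrier B \<and> isCont F p \<and>
     (\<forall>D \<phi> E \<psi>. (D, \<phi>) \<in> A \<and> p \<in> D \<and> (E, \<psi>) \<in> B \<and> F p \<in> E \<longrightarrow>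
        smooth_at (\<phi> p) (\<lambda>y. \<psi> (F (inv_into D \<phi> y))))"

lemma smooth_map_atD:
  assumes "smooth_map_at A B F p"
  shows "p \<in> carrier A" "F p \<in> carrier B" "isCont F p"
    "\<And>D \<phi> E \<psi>. (D, \<phi>) \<in> A \<Longrightarrow> p \<in> D \<Longrightarrow> (E, \<psi>) \<in> B \<Longrightarrow> F p \<in> E \<Longrightarrow>
        smooth_at (\<phi> p) (\<lambda>y. \<psi> (F (inv_into D \<phi> y)))"
  using assms unfolding smooth_map_at_def by auto

lemma smooth_map_at_local:
  assumes A: "smooth_manifold A" and B: "smooth_manifold B" and F: "smooth_map_at A B F p"
    and D: "(D, \<phi>) \<in> A" "p \<in> D" and E: "(E, \<psi>) \<in> B" "F p \<in> E"
  obtains S where "open S" "\<phi> p \<in> S"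
    "\<And>y. y \<in> S \<Longrightarrow> inv_into E \<psi> (\<psi> (F (inv_into D \<phi> y))) = F (inv_into D \<phi> y)"
proof -
  have "\<exists>V. open V \<and> p \<in> V \<and> (\<forall>x\<in>V. F x \<in> E)"
    using smooth_map_atD(3)[OF F] chart_facts(1)[OF B E(1)] E(2) by (simp add: continuous_at_open)
  then obtain V where V: "open V" "p \<in> V" "\<forall>x\<in>V. F x \<in> E" by blast
  show ?thesis
  proof (rule that)
    show "open (\<phi> ` (V \<inter> D))" using open_chart_image[OF A D(1) V(1)] .
    show "\<phi> p \<in> \<phi> ` (V \<inter> D)" using V(2) D(2) by blast
    show "inv_into E \<psi> (\<psi> (F (inv_into D \<phi> y))) = F (inv_into D \<phi> y)" if "y \<in> \<phi> ` (V \<inter> D)" for y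
      using that V(3) chart_facts(5)[OF A D(1)] chart_facts(5)[OF B E(1)] by auto
  qed
qed

lemma smooth_near_compose:
  assumes A: "smooth_manifold A" and B: "smooth_manifold B" and F: "smooth_map_at A B F p"
    and f: "smooth_near B (F p) f"
  shows "smooth_near A p (\<lambda>x. f (F x))"
proof -
  obtain D \<phi> where D: "(D, \<phi>) \<in> A" "p \<in> D" using carrierE smooth_map_atD(1)[OF F] by metis
  obtain E \<psi> where E: "(E, \<psi>) \<in> B" "F p \<in> E" using carrierE smooth_map_atD(2)[OF F] by metis
  obtain S where S: "open S" "\<phi> p \<in> S"
    "\<And>y. y \<in> S \<Longrightarrow> inv_into E \<psi> (\<psi> (F (inv_into D \<phi> y))) = F (inv_into D \<phi> y)"
    using smooth_map_at_local[OF A B F D E] by blast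
  have "smooth_at (\<psi> (F (inv_into D \<phi> (\<phi> p)))) (f \<circ> inv_into E \<psi>)"
    using f smooth_near_iff[OF B E] chart_facts(5)[OF A D(1) D(2)] by simp
  from smooth_at_compose[OF smooth_map_atD(4)[OF F D E] this]
  have "smooth_at (\<phi> p) ((\<lambda>x. f (F x)) \<circ> inv_into D \<phi>)"
    by (rule smooth_at_cong[OF _ S(1,2)]) (use S(3) in auto)
  then show ?thesis using smooth_near_iff[OF A D] by simp
qed

lemma smooth_map_at_ident:
  assumes "smooth_manifold A" "p \<in> carrier A"
  shows "smooth_map_at A A (\<lambda>x. x) p"
  unfolding smooth_map_at_def
proof (intro conjI allI impI)
  fix D \<phi> E \<psi> assume *: "(D, \<phi>) \<in> A \<and> p \<in> D \<and> (E, \<psi>) \<in> A \<and> p \<in> E"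
  have "C_infinity (\<phi> ` (D \<inter> E)) (\<psi> \<circ> inv_into D \<phi>)"
    using * assms unfolding smooth_manifold_def by fast
  moreover have "open (\<phi> ` (D \<inter> E))"
    using open_chart_image[OF assms(1), of D \<phi> E] chart_facts(1)[OF assms(1), of E \<psi>] *
    by (simp add: Int_commute)
  ultimately show "smooth_at (\<phi> p) (\<lambda>y. \<psi> (inv_into D \<phi> y))"
    using * C_infinity_imp_smooth_at[of "\<phi> ` (D \<inter> E)" "\<phi> p" "\<psi> \<circ> inv_into D \<phi>"]
    by (auto simp: comp_def)
qed (use assms in auto)

lemma smooth_map_at_compose:
  assumes A: "smooth_manifold A" and B: "smooth_manifold B"
    and F: "smooth_map_at A B F p" and H: "smooth_map_at B C H (F p)"
  shows "smooth_map_at A C (\<lambda>x. H (F x)) p"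
  unfolding smooth_map_at_def
proof (intro conjI allI impI)
  show "isCont (\<lambda>x. H (F x)) p"
    using isCont_o2[OF smooth_map_atD(3)[OF F] smooth_map_atD(3)[OF H]] .
  fix D \<phi> E' \<eta> assume *: "(D, \<phi>) \<in> A \<and> p \<in> D \<and> (E', \<eta>) \<in> C \<and> H (F p) \<in> E'"
  then have D: "(D, \<phi>) \<in> A" "p \<in> D" by auto
  obtain E \<psi> where E: "(E, \<psi>) \<in> B" "F p \<in> E" using carrierE smooth_map_atD(2)[OF F] by metis
  obtain S where S: "open S" "\<phi> p \<in> S"
    "\<And>y. y \<in> S \<Longrightarrow> inv_into E \<psi> (\<psi> (F (inv_into D \<phi> y))) = F (inv_into D \<phi> y)"
    using smooth_map_at_local[OF A B F D E] by blast
  have "smooth_at (\<psi> (F (inv_into D \<phi> (\<phi> p)))) (\<lambda>y. \<eta> (H (inv_into E \<psi> y)))"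
    using smooth_map_atD(4)[OF H E, of E' \<eta>] * chart_facts(5)[OF A D(1) D(2)] by simp
  from smooth_at_compose[OF smooth_map_atD(4)[OF F D E] this]
  show "smooth_at (\<phi> p) (\<lambda>y. \<eta> (H (F (inv_into D \<phi> y))))"
    by (rule smooth_at_cong[OF _ S(1,2)]) (use S(3) in auto)
qed (use smooth_map_atD[OF F] smooth_map_atD[OF H] in auto)

text \<open>The tangent vector at \<open>p\<close> whose coordinate vector in the chart \<open>(D, \<phi>)\<close> is \<open>w\<close>, normalised
  to zero on functions that are not smooth near \<open>p\<close>.\<close>

definition chart_vec ::
  "('m::topological_space, 'e::euclidean_space) chart set \<Rightarrow> 'm set \<Rightarrow> ('m \<Rightarrow> 'e) \<Rightarrow> 'm \<Rightarrow> 'e \<Rightarrow> 'm tvec"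
  where
  "chart_vec A D \<phi> p w = (\<lambda>f. if smooth_near A p f
      then frechet_derivative (f \<circ> inv_into D \<phi>) (at (\<phi> p)) w else 0)"

lemma chart_vec_tangent: "(D, \<phi>) \<in> A \<Longrightarrow> p \<in> D \<Longrightarrow> chart_vec A D \<phi> p w \<in> tangent_space A p"
  unfolding tangent_space_def chart_vec_def by blast

lemma tangent_spaceE:
  assumes "v \<in> tangent_space A p"
  obtains D \<phi> w where "(D, \<phi>) \<in> A" "p \<in> D" "v = chart_vec A D \<phi> p w"
  using assms unfolding tangent_space_def chart_vec_def by fast

lemma tangent_space_carrier: "v \<in> tangent_space A p \<Longrightarrow> p \<in> carrier A"
  unfolding tangent_space_def carrier_def by fast

lemma tangent_not_smooth: "v \<in> tangent_space A p \<Longrightarrow> \<not> smooth_near A p f \<Longrightarrow> v f = 0"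
  by (erule tangent_spaceE) (simp add: chart_vec_def)

lemma differentiable_in_chart:
  assumes "smooth_manifold A" "(D, \<phi>) \<in> A" "p \<in> D" "smooth_near A p f"
  shows "(f \<circ> inv_into D \<phi>) differentiable (at (\<phi> p))"
  using smooth_near_iff[OF assms(1-3)] smooth_at_differentiable assms(4) by blast

text \<open>The chain rule, for the map induced by \<open>F\<close> on tangent vectors.\<close>

lemma tmap_chart_vec:
  assumes A: "smooth_manifold A" and B: "smooth_manifold B" and F: "smooth_map_at A B F p"
    and D: "(D, \<phi>) \<in> A" "p \<in> D" and E: "(E, \<psi>) \<in> B" "F p \<in> E"
  shows "tmap B F p (chart_vec A D \<phi> p w) =
    chart_vec B E \<psi> (F p) (frechet_derivative (\<lambda>y. \<psi> (F (inv_into D \<phi> y))) (at (\<phi> p)) w)"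
proof
  fix f :: "'c \<Rightarrow> real"
  let ?F = "\<lambda>y. \<psi> (F (inv_into D \<phi> y))"
  let ?f = "f \<circ> inv_into E \<psi>"
  obtain S where S: "open S" "\<phi> p \<in> S"
    "\<And>y. y \<in> S \<Longrightarrow> inv_into E \<psi> (?F y) = F (inv_into D \<phi> y)"
    using smooth_map_at_local[OF A B F D E] by blast
  show "tmap B F p (chart_vec A D \<phi> p w) f =
      chart_vec B E \<psi> (F p) (frechet_derivative ?F (at (\<phi> p)) w) f"
  proof (cases "smooth_near B (F p) f")
    case True
    then have n: "smooth_near A p (f \<circ> F)" using smooth_near_compose[OF A B F] by (simp add: comp_def)
    have Fp: "?F (\<phi> p) = \<psi> (F p)" using chart_facts(5)[OF A D(1) D(2)] by simp
    have 1: "(?F has_derivative frechet_derivative ?F (at (\<phi> p))) (at (\<phi> p))"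
      using smooth_at_differentiable[OF smooth_map_atD(4)[OF F D E]] frechet_derivative_works by blast
    have 2: "(?f has_derivative frechet_derivative ?f (at (\<psi> (F p)))) (at (?F (\<phi> p)))"
      using differentiable_in_chart[OF B E True] frechet_derivative_works Fp by metis
    have "frechet_derivative (f \<circ> F \<circ> inv_into D \<phi>) (at (\<phi> p)) =
        frechet_derivative (\<lambda>y. ?f (?F y)) (at (\<phi> p))"
      by (rule frechet_derivative_cong_open[OF S(1,2)]) (use S(3) in simp)
    also have "\<dots> = (\<lambda>v. frechet_derivative ?f (at (\<psi> (F p))) (frechet_derivative ?F (at (\<phi> p)) v))"
      using frechet_derivative_at[OF has_derivative_compose[OF 1 2]] by simp
    finally show ?thesis using True n by (simp add: tmap_def chart_vec_def)
  qed (simp add: tmap_def chart_vec_def)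
qed

lemma tmap_tangent:
  assumes "smooth_manifold A" "smooth_manifold B" "smooth_map_at A B F p" "v \<in> tangent_space A p"
  shows "tmap B F p v \<in> tangent_space B (F p)"
proof -
  obtain E \<psi> where E: "(E, \<psi>) \<in> B" "F p \<in> E" using carrierE smooth_map_atD(2)[OF assms(3)] by metis
  show ?thesis
    using assms(4)
    by (rule tangent_spaceE) (simp add: tmap_chart_vec[OF assms(1-3) _ _ E] chart_vec_tangent E)
qed

lemma tmap_ident: "v \<in> tangent_space A p \<Longrightarrow> tmap A (\<lambda>x. x) p v = v"
  using tangent_not_smooth[of v A p] by (simp add: tmap_def comp_def fun_eq_iff)

lemma tangent_in_chart:
  assumes A: "smooth_manifold A" and v: "v \<in> tangent_space A p" and E: "(E, \<psi>) \<in> A" "p \<in> E"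
  obtains w where "v = chart_vec A E \<psi> p w"
proof -
  obtain D \<phi> w where D: "(D, \<phi>) \<in> A" "p \<in> D" "v = chart_vec A D \<phi> p w"
    using v by (rule tangent_spaceE)
  have "smooth_map_at A A (\<lambda>x. x) p" using smooth_map_at_ident[OF A tangent_space_carrier[OF v]] .
  from tmap_chart_vec[OF A A this D(1,2) E, of w] show ?thesis
    using that tmap_ident[OF v] D(3) by metis
qed

lemma chart_vec_linear:
  assumes "smooth_manifold A" "(D, \<phi>) \<in> A" "p \<in> D"
  shows "chart_vec A D \<phi> p (a *\<^sub>R u + b *\<^sub>R w) =
    a *\<^sub>T chart_vec A D \<phi> p u + b *\<^sub>T chart_vec A D \<phi> p w"
proof
  fix f
  show "chart_vec A D \<phi> p (a *\<^sub>R u + b *\<^sub>R w) f =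
      (a *\<^sub>T chart_vec A D \<phi> p u + b *\<^sub>T chart_vec A D \<phi> p w) f"
    using linear_frechet_derivative[OF differentiable_in_chart[OF assms, of f]]
    by (auto simp: chart_vec_def tscale_def linear_add linear_scale)
qed

lemma tangent_lincomb:
  assumes A: "smooth_manifold A" and "u \<in> tangent_space A p" "v \<in> tangent_space A p"
  shows "a *\<^sub>T u + b *\<^sub>T v \<in> tangent_space A p"
proof -
  obtain D \<phi> w where D: "(D, \<phi>) \<in> A" "p \<in> D" "u = chart_vec A D \<phi> p w"
    using assms(2) by (rule tangent_spaceE)
  obtain w' where "v = chart_vec A D \<phi> p w'" using tangent_in_chart[OF A assms(3) D(1,2)] .
  then show ?thesis
    using D chart_vec_linear[OF A D(1,2), of a w b w'] chart_vec_tangent[OF D(1,2)] by metis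
qed

lemma tscale_simps [simp]:
  "1 *\<^sub>T v = v" "0 *\<^sub>T v = 0" "a *\<^sub>T 0 = 0" "(- 1) *\<^sub>T v = - v"
  by (auto simp: tscale_def)

lemma tangent_diff:
  assumes "smooth_manifold A" "u \<in> tangent_space A p" "v \<in> tangent_space A p"
  shows "u - v \<in> tangent_space A p"
  using tangent_lincomb[OF assms, of 1 "- 1"] by simp

lemma tangent_scale:
  assumes "smooth_manifold A" "u \<in> tangent_space A p"
  shows "a *\<^sub>T u \<in> tangent_space A p"
  using tangent_lincomb[OF assms assms(2), of a 0] by simp

lemma tangent_zero:
  assumes "p \<in> carrier A" "smooth_manifold A"
  shows "0 \<in> tangent_space A p"
proof -
  obtain D \<phi> where D: "(D, \<phi>) \<in> A" "p \<in> D" using carrierE assms(1) by metis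
  show ?thesis using tangent_scale[OF assms(2) chart_vec_tangent[OF D, of 0], of 0] by simp
qed

lemma tmap_compose:
  assumes "smooth_manifold B" "smooth_manifold C" "smooth_map_at B C H (F p)"
  shows "tmap C H (F p) (tmap B F p v) = tmap C (\<lambda>x. H (F x)) p v"
  using smooth_near_compose[OF assms] by (auto simp: tmap_def comp_def)

lemma tmap_add: "tmap B F p (u + v) = tmap B F p u + tmap B F p v"
  by (auto simp: tmap_def)

lemma tmap_diff: "tmap B F p (u - v) = tmap B F p u - tmap B F p v"
  by (auto simp: tmap_def)

lemma tmap_zero: "tmap B F p 0 = 0"
  by (auto simp: tmap_def)

text \<open>A tangent vector depends only on the germ of its argument.\<close>

lemma tangent_local:
  assumes A: "smooth_manifold A" and v: "v \<in> tangent_space A p"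
    and U: "open U" "p \<in> U" "\<And>q. q \<in> U \<Longrightarrow> f q = h q"
  shows "v f = v h"
proof -
  obtain D \<phi> w where D: "(D, \<phi>) \<in> A" "p \<in> D" "v = chart_vec A D \<phi> p w"
    using v by (rule tangent_spaceE)
  have "frechet_derivative (f \<circ> inv_into D \<phi>) (at (\<phi> p)) = frechet_derivative (h \<circ> inv_into D \<phi>) (at (\<phi> p))"
    by (rule frechet_derivative_cong_open[OF open_chart_image[OF A D(1) U(1)]])
      (use U D chart_facts(5)[OF A D(1)] in auto)
  then show ?thesis
    unfolding D(3) chart_vec_def using smooth_near_cong_iff[OF A U] by simp
qed

lemma tangent_const: "v \<in> tangent_space A p \<Longrightarrow> v (\<lambda>x. c) = 0"
  by (erule tangent_spaceE) (simp add: chart_vec_def comp_def)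

lemma chart_vec_coordinate:
  assumes A: "smooth_manifold A" and D: "(D, \<phi>) \<in> A" "p \<in> D"
  shows "chart_vec A D \<phi> p w (\<lambda>x. \<phi> x \<bullet> i) = w \<bullet> i"
proof -
  note c = chart_facts[OF A D(1)]
  have "frechet_derivative ((\<lambda>x. \<phi> x \<bullet> i) \<circ> inv_into D \<phi>) (at (\<phi> p)) =
      frechet_derivative (\<lambda>y. y \<bullet> i) (at (\<phi> p))"
    by (rule frechet_derivative_cong_open[OF c(2)]) (use D in \<open>auto simp: c(7)\<close>)
  also have "\<dots> = (\<lambda>y. y \<bullet> i)"
    using frechet_derivative_at[OF bounded_linear_imp_has_derivative[OF bounded_linear_inner_left]]
    by metis
  finally show ?thesis using smooth_near_coordinate[OF A D] by (simp add: chart_vec_def)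
qed

text \<open>A tangent vector is the combination of the coordinate vectors with coefficients its values on
  the coordinate functions.\<close>

lemma tangent_expand:
  assumes A: "smooth_manifold A" and D: "(D, \<phi>) \<in> A" "p \<in> D" and v: "v \<in> tangent_space A p"
  shows "v f = (\<Sum>i\<in>Basis. v (\<lambda>x. \<phi> x \<bullet> i) * chart_vec A D \<phi> p i f)"
proof -
  obtain w where w: "v = chart_vec A D \<phi> p w" using tangent_in_chart[OF A v D] .
  show ?thesis
  proof (cases "smooth_near A p f")
    case True
    then show ?thesis
      using frechet_derivative_eq_sum_Basis[OF differentiable_in_chart[OF A D True], of w]
      unfolding w chart_vec_coordinate[OF A D] by (simp add: chart_vec_def)
  qed (simp add: w chart_vec_def)
qed


section \<open>Vector fields\<close>

text \<open>Smooth sections, characterised by their action on germs.\<close>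

lemma fields_along_iff:
  assumes A: "smooth_manifold A" and B: "smooth_manifold B"
    and U: "open U" "U \<subseteq> carrier A" and F: "\<And>p. p \<in> U \<Longrightarrow> isCont F p"
  shows "W \<in> fields_along A B F U \<longleftrightarrow> (\<forall>p\<in>U. W p \<in> tangent_space B (F p) \<and>
     (\<forall>f. smooth_near B (F p) f \<longrightarrow> smooth_near A p (\<lambda>q. W q f)))"
proof -
  have O: "open (U \<inter> F -` N)" "U \<inter> F -` N \<subseteq> carrier A" if "open N" for N
    using U F that by (auto intro!: continuous_open_preimage continuous_at_imp_continuous_on)
  show ?thesis
  proof
    assume W: "W \<in> fields_along A B F U"
    show "\<forall>p\<in>U. W p \<in> tangent_space B (F p) \<and>
       (\<forall>f. smooth_near B (F p) f \<longrightarrow> smooth_near A p (\<lambda>q. W q f))"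
    proof (intro ballI conjI allI impI)
      fix p f assume p: "p \<in> U"
      then show "W p \<in> tangent_space B (F p)" using W by (auto simp: fields_along_def)
      assume "smooth_near B (F p) f"
      then obtain N where N: "open N" "F p \<in> N" "N \<subseteq> carrier B" "smooth_fun B N f"
        unfolding smooth_near_def by blast
      then have "smooth_fun A (U \<inter> F -` N) (\<lambda>p. W p f)" using W by (auto simp: fields_along_def)
      then show "smooth_near A p (\<lambda>q. W q f)"
        unfolding smooth_near_def using O[OF N(1)] p N(2) by (intro exI[of _ "U \<inter> F -` N"]) auto
    qed
  next
    assume W: "\<forall>p\<in>U. W p \<in> tangent_space B (F p) \<and>
       (\<forall>f. smooth_near B (F p) f \<longrightarrow> smooth_near A p (\<lambda>q. W q f))"
    have "smooth_fun A (U \<inter> F -` N) (\<lambda>p. W p f)"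
      if "open N" "N \<subseteq> carrier B" "smooth_fun B N f" for N f
      using that W by (simp add: smooth_fun_iff[OF A O] smooth_fun_iff[OF B])
    then show "W \<in> fields_along A B F U" unfolding fields_along_def using W by auto
  qed
qed

lemma vfields_iff:
  assumes "smooth_manifold A" "open U" "U \<subseteq> carrier A"
  shows "X \<in> vfields A U \<longleftrightarrow> (\<forall>p\<in>U. X p \<in> tangent_space A p \<and>
     (\<forall>f. smooth_near A p f \<longrightarrow> smooth_near A p (\<lambda>q. X q f)))"
  unfolding vfields_def using fields_along_iff[OF assms(1) assms(1) assms(2,3)] by simp

lemma global_vfieldsD:
  assumes "smooth_manifold A" "X \<in> \<XX> A" "p \<in> carrier A"
  shows "X p \<in> tangent_space A p" "smooth_near A p f \<Longrightarrow> smooth_near A p (\<lambda>q. X q f)"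
  using assms vfields_iff[OF assms(1) open_carrier[OF assms(1)]] by auto

lemma vfields_restrict:
  assumes "smooth_manifold A" "X \<in> \<XX> A" "open U" "U \<subseteq> carrier A"
  shows "X \<in> vfields A U"
  using global_vfieldsD[OF assms(1,2)] assms(4) by (auto simp: vfields_iff[OF assms(1,3,4)])

lemma smooth_near_chart_vec:
  assumes A: "smooth_manifold A" and D: "(D, \<phi>) \<in> A" "p \<in> D" and f: "smooth_near A p f"
  shows "smooth_near A p (\<lambda>q. chart_vec A D \<phi> q w f)"
proof -
  note c = chart_facts[OF A D(1)]
  obtain U where U: "open U" "p \<in> U" "U \<subseteq> carrier A" "\<And>q. q \<in> U \<Longrightarrow> smooth_near A q f"
    by (rule smooth_near_open[OF A f]) blast
  have "smooth_at (\<phi> p) (\<lambda>y. frechet_derivative (f \<circ> inv_into D \<phi>) (at y) w)"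
    using f smooth_near_iff[OF A D] smooth_at_frechet_derivative by blast
  then have "smooth_at (\<phi> p) ((\<lambda>q. chart_vec A D \<phi> q w f) \<circ> inv_into D \<phi>)"
    by (rule smooth_at_cong[OF _ open_chart_image[OF A D(1) U(1)]])
      (use U(2,4) D(2) c(5) in \<open>auto simp: chart_vec_def\<close>)
  then show ?thesis using smooth_near_iff[OF A D] by simp
qed

lemma chart_vec_vfield:
  assumes "smooth_manifold A" "(D, \<phi>) \<in> A"
  shows "(\<lambda>q. chart_vec A D \<phi> q w) \<in> vfields A D"
proof -
  have "D \<subseteq> carrier A" using chart_facts(6)[OF assms] by blast
  then show ?thesis
    using chart_vec_tangent[OF assms(2)] smooth_near_chart_vec[OF assms]
    by (simp add: vfields_iff[OF assms(1) chart_facts(1)[OF assms]])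
qed

text \<open>Every tangent vector extends to a global vector field: multiply a coordinate field by a bump
  function whose support is compact inside the chart.\<close>

lemma tangent_extends:
  assumes A: "smooth_manifold A" and v: "v \<in> tangent_space A p"
  obtains X where "X \<in> \<XX> A" "X p = v"
proof -
  obtain D \<phi> w where D: "(D, \<phi>) \<in> A" "p \<in> D" "v = chart_vec A D \<phi> p w"
    using v by (rule tangent_spaceE)
  note c = chart_facts[OF A D(1)]
  obtain e where e: "e > 0" "cball (\<phi> p) e \<subseteq> \<phi> ` D"
    using c(2) D(2) unfolding open_contains_cball by blast
  obtain b :: "_ \<Rightarrow> real" where b: "\<forall>y. smooth_at y b" "b (\<phi> p) = 1" "\<forall>y. e \<le> dist (\<phi> p) y \<longrightarrow> b y = 0"
    using smooth_bump[OF e(1), of "\<phi> p"] by blast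
  define X where "X q = (if q \<in> D then b (\<phi> q) *\<^sub>T chart_vec A D \<phi> q w else 0)" for q
  define K where "K = inv_into D \<phi> ` cball (\<phi> p) e"
  have "compact K"
    unfolding K_def
    using continuous_on_subset[OF c(4) e(2)] by (intro compact_continuous_image) auto
  then have K: "open (- K)" using compact_imp_closed by blast
  \<comment> \<open>The complement of \<open>K\<close> is an open set on which the field vanishes, and it covers all points
    outside the chart.\<close>
  have X0: "X q = 0" if "q \<notin> K" for q
  proof (cases "q \<in> D")
    case True
    have "\<phi> q \<notin> cball (\<phi> p) e"
    proof
      assume "\<phi> q \<in> cball (\<phi> p) e"
      then have "inv_into D \<phi> (\<phi> q) \<in> K" unfolding K_def by blast
      then show False using c(5)[OF True] that by simp
    qed
    then show ?thesis using b(3) by (simp add: X_def)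
  qed (simp add: X_def)
  have "X \<in> \<XX> A"
    unfolding vfields_iff[OF A open_carrier[OF A] order_refl]
  proof (intro ballI conjI allI impI)
    fix q assume q: "q \<in> carrier A"
    show "X q \<in> tangent_space A q"
      using tangent_scale[OF A chart_vec_tangent[OF D(1)]] tangent_zero[OF q A] by (simp add: X_def)
    fix f assume f: "smooth_near A q f"
    show "smooth_near A q (\<lambda>q. X q f)"
    proof (cases "q \<in> D")
      case True
      have "smooth_at (\<phi> q) ((\<lambda>x. b (\<phi> x)) \<circ> inv_into D \<phi>)"
        by (rule smooth_at_cong[OF b(1)[rule_format] c(2)]) (use True in \<open>auto simp: c(7)\<close>)
      then have "smooth_near A q (\<lambda>x. b (\<phi> x) * chart_vec A D \<phi> x w f)"
        using smooth_near_mult[OF A _ smooth_near_chart_vec[OF A D(1) True f]]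
          smooth_near_iff[OF A D(1) True] by blast
      then show ?thesis
        by (rule smooth_near_cong[OF A _ c(1) True]) (simp add: X_def tscale_def)
    next
      case False
      have "K \<subseteq> D" using e(2) by (auto simp: K_def intro: inv_into_into)
      then show ?thesis
        using False X0 by (intro smooth_near_cong[OF A smooth_near_const[OF A q, of 0] K]) auto
    qed
  qed
  moreover have "X p = v" using D b(2) by (simp add: X_def)
  ultimately show ?thesis using that by blast
qed


section \<open>Products with an open subset of a Euclidean space\<close>

lemma inv_into_open_times:
  assumes "inj_on \<phi> D" "s \<in> I" "y \<in> \<phi> ` D"
  shows "inv_into (I \<times> D) (\<lambda>(s, x). (s, \<phi> x)) (s, y) = (s, inv_into D \<phi> y)"
proof -
  obtain x where x: "x \<in> D" "y = \<phi> x" using assms(3) by blast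
  have "inj_on (\<lambda>(s, x). (s, \<phi> x)) (I \<times> D)"
    using assms(1) by (auto simp: inj_on_def)
  from inv_into_f_f[OF this, of "(s, x)"] show ?thesis
    using x assms by (simp add: inv_into_f_f)
qed

lemma chart_inj: "smooth_manifold A \<Longrightarrow> (D, \<phi>) \<in> A \<Longrightarrow> inj_on \<phi> D"
  using chart_facts(5) by (metis inj_on_inverseI)

lemma image_open_times: "(\<lambda>(s, x). (s, \<phi> x)) ` (I \<times> D) = I \<times> \<phi> ` D"
  by force

lemma open_timesE:
  assumes "(E, \<psi>) \<in> open_times I A"
  obtains D \<phi> where "(D, \<phi>) \<in> A" "E = I \<times> D" "\<psi> = (\<lambda>(s, x). (s, \<phi> x))"
  using assms unfolding open_times_def by auto

lemma open_times_chart: "(D, \<phi>) \<in> A \<Longrightarrow> (I \<times> D, \<lambda>(s, x). (s, \<phi> x)) \<in> open_times I A"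
  unfolding open_times_def by force

lemma carrier_open_times: "carrier (open_times I A) = I \<times> carrier A"
  unfolding carrier_def open_times_def by auto

lemma smooth_manifold_open_times:
  fixes I :: "'s::euclidean_space set"
  assumes A: "smooth_manifold A" and I: "open I"
  shows "smooth_manifold (open_times I A)"
  unfolding smooth_manifold_def
proof (intro conjI; safe elim!: open_timesE)
  fix D \<phi> assume D: "(D, \<phi>) \<in> A"
  note c = chart_facts[OF A D]
  let ?\<Phi> = "\<lambda>(s, x). (s, \<phi> x)"
  let ?\<Psi> = "\<lambda>(s, y). (s, inv_into D \<phi> y)"
  show "open (I \<times> D)" using I c(1) by (rule open_Times)
  show "open (?\<Phi> ` (I \<times> D))" unfolding image_open_times using I c(2) by (rule open_Times)
  show "homeomorphism (I \<times> D) (?\<Phi> ` (I \<times> D)) ?\<Phi> (inv_into (I \<times> D) ?\<Phi>)"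
    unfolding homeomorphism_def
  proof (intro conjI ballI)
    show "continuous_on (I \<times> D) ?\<Phi>"
      unfolding case_prod_unfold
      by (intro continuous_intros continuous_on_compose2[OF c(3)]) auto
    have "continuous_on (I \<times> \<phi> ` D) ?\<Psi>"
      unfolding case_prod_unfold
      by (intro continuous_intros continuous_on_compose2[OF c(4)]) auto
    then show *: "continuous_on (?\<Phi> ` (I \<times> D)) (inv_into (I \<times> D) ?\<Phi>)"
      unfolding image_open_times
      by (rule continuous_on_eq) (auto simp: inv_into_open_times[OF chart_inj[OF A D] _ imageI])
    show inv: "inv_into (I \<times> D) ?\<Phi> (?\<Phi> x) = x" if "x \<in> I \<times> D" for x
      using that c(5) by (auto simp: inv_into_open_times[OF chart_inj[OF A D] _ imageI])
    show "inv_into (I \<times> D) ?\<Phi> ` ?\<Phi> ` (I \<times> D) = I \<times> D"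
      using inv by force
    show "?\<Phi> (inv_into (I \<times> D) ?\<Phi> y) = y" if "y \<in> ?\<Phi> ` (I \<times> D)" for y
      using that by (rule f_inv_into_f)
  qed simp
next
  fix D \<phi> E \<psi> assume D: "(D, \<phi>) \<in> A" and E: "(E, \<psi>) \<in> A"
  note c = chart_facts[OF A D] and cE = chart_facts[OF A E]
  let ?\<Phi> = "\<lambda>(s, x). (s, \<phi> x)"
  have im: "?\<Phi> ` (I \<times> D \<inter> I \<times> E) = I \<times> \<phi> ` (D \<inter> E)" by force
  show "C_infinity (?\<Phi> ` (I \<times> D \<inter> I \<times> E)) ((\<lambda>(s, x). (s, \<psi> x)) \<circ> inv_into (I \<times> D) ?\<Phi>)"
    unfolding im
  proof (rule smooth_at_imp_C_infinity)
    fix z assume "z \<in> I \<times> \<phi> ` (D \<inter> E)"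
    then obtain s x where z: "z = (s, \<phi> x)" "s \<in> I" "x \<in> D" "x \<in> E" by auto
    have "smooth_at (\<phi> x) (\<lambda>y. \<psi> (inv_into D \<phi> y))"
      using smooth_map_atD(4)[OF smooth_map_at_ident[OF A c(6)[OF z(3)]] D z(3) E z(4)] .
    then have "smooth_at z (\<lambda>u. (fst u, \<psi> (inv_into D \<phi> (snd u))))"
      using z(1) smooth_at_compose[OF smooth_at_linear[OF bounded_linear_snd], of z
          "\<lambda>y. \<psi> (inv_into D \<phi> y)"]
      by (intro smooth_at_Pair smooth_at_linear[OF bounded_linear_fst]) simp
    then show "smooth_at z ((\<lambda>(s, x). (s, \<psi> x)) \<circ> inv_into (I \<times> D) ?\<Phi>)"
    proof (rule smooth_at_cong)
      show "open (I \<times> \<phi> ` D)" using I c(2) by (rule open_Times)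
      show "z \<in> I \<times> \<phi> ` D" using z by blast
    qed (auto simp: inv_into_open_times[OF chart_inj[OF A D] _ imageI] c(5))
  qed
qed

lemma smooth_map_at_slice:
  fixes I :: "'s::euclidean_space set"
  assumes A: "smooth_manifold A" and s: "s \<in> I" and p: "p \<in> carrier A"
  shows "smooth_map_at A (open_times I A) (\<lambda>x. (s, x)) p"
  unfolding smooth_map_at_def
proof (intro conjI allI impI; (elim conjE open_timesE)?)
  show "isCont (\<lambda>x. (s, x)) p" by (intro continuous_intros)
  fix D \<phi> E D' \<phi>' and \<psi> :: "'s \<times> 'a \<Rightarrow> 's \<times> 'b"
  assume D: "(D, \<phi>) \<in> A" "p \<in> D" "(s, p) \<in> E" and D': "(D', \<phi>') \<in> A" "E = I \<times> D'" "\<psi> = (\<lambda>(s, x). (s, \<phi>' x))"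
  then have "smooth_at (\<phi> p) (\<lambda>y. (s, \<phi>' (inv_into D \<phi> y)))"
    using smooth_map_atD(4)[OF smooth_map_at_ident[OF A p] D(1,2) D'(1)]
    by (intro smooth_at_Pair smooth_at_const) auto
  then show "smooth_at (\<phi> p) (\<lambda>y. \<psi> (s, inv_into D \<phi> y))" using D' by simp
qed (use s p in \<open>auto simp: carrier_open_times\<close>)

text \<open>In a product chart, local representations may be computed with the product of the inverse
  charts.\<close>

lemma smooth_at_product_chart:
  fixes I :: "'s::euclidean_space set"
  assumes A: "smooth_manifold A" and I: "open I" and D: "(D, \<phi>) \<in> A" and s: "s \<in> I" "p \<in> D"
    and f: "smooth_at (s, \<phi> p) (\<lambda>(s, y). f (s, inv_into D \<phi> y))"
  shows "smooth_at ((\<lambda>(s, x). (s, \<phi> x)) (s, p)) (\<lambda>y. f (inv_into (I \<times> D) (\<lambda>(s, x). (s, \<phi> x)) y))"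
proof -
  have "smooth_at (s, \<phi> p) (\<lambda>y. f (inv_into (I \<times> D) (\<lambda>(s, x). (s, \<phi> x)) y))"
    using f
  proof (rule smooth_at_cong)
    show "open (I \<times> \<phi> ` D)" using I chart_facts(2)[OF A D] by (rule open_Times)
    show "(s, \<phi> p) \<in> I \<times> \<phi> ` D" using s by blast
  qed (auto simp: inv_into_open_times[OF chart_inj[OF A D] _ imageI])
  then show ?thesis by simp
qed

lemma smooth_map_at_snd:
  fixes I :: "'s::euclidean_space set"
  assumes A: "smooth_manifold A" and I: "open I" and q: "q \<in> carrier (open_times I A)"
  shows "smooth_map_at (open_times I A) A snd q"
  unfolding smooth_map_at_def
proof (intro conjI allI impI; (elim conjE open_timesE)?)
  show "isCont snd q" by (intro continuous_intros)
  fix D E \<psi> D' \<phi>' and \<phi> :: "'s \<times> 'a \<Rightarrow> 's \<times> 'b"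
  assume D: "q \<in> D" "(E, \<psi>) \<in> A" "snd q \<in> E" "(D', \<phi>') \<in> A" "D = I \<times> D'" "\<phi> = (\<lambda>(s, x). (s, \<phi>' x))"
  obtain s p where sp: "q = (s, p)" "s \<in> I" "p \<in> D'" using D by auto
  have "smooth_at (\<phi>' p) (\<lambda>y. \<psi> (inv_into D' \<phi>' y))"
    using smooth_map_atD(4)[OF smooth_map_at_ident[OF A] D(4) _ D(2)] sp D(3) chart_facts(6)[OF A D(4)]
    by simp
  then have "smooth_at (s, \<phi>' p) (\<lambda>z. \<psi> (inv_into D' \<phi>' (snd z)))"
    using smooth_at_compose[OF smooth_at_linear[OF bounded_linear_snd], of "(s, \<phi>' p)"
        "\<lambda>y. \<psi> (inv_into D' \<phi>' y)"] by simp
  then show "smooth_at (\<phi> q) (\<lambda>y. \<psi> (snd (inv_into D \<phi> y)))"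
    unfolding D(5,6) sp(1)
    by (intro smooth_at_product_chart[OF A I D(4) sp(2,3), of "\<lambda>z. \<psi> (snd z)"])
      (simp add: case_prod_unfold)
qed (use q in \<open>auto simp: carrier_open_times\<close>)

lemma smooth_map_at_enlarge:
  fixes I :: "'s::euclidean_space set"
  assumes A: "smooth_manifold A" and I: "open I" and IJ: "I \<subseteq> J" and q: "q \<in> carrier (open_times I A)"
  shows "smooth_map_at (open_times I A) (open_times J A) (\<lambda>x. x) q"
  unfolding smooth_map_at_def
proof (intro conjI allI impI; (elim conjE open_timesE)?)
  fix D E D' \<phi>' E' \<psi>' and \<phi> \<psi> :: "'s \<times> 'a \<Rightarrow> 's \<times> 'b"
  assume D: "q \<in> D" "q \<in> E" "(D', \<phi>') \<in> A" "D = I \<times> D'" "\<phi> = (\<lambda>(s, x). (s, \<phi>' x))"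
    and E: "(E', \<psi>') \<in> A" "E = J \<times> E'" "\<psi> = (\<lambda>(s, x). (s, \<psi>' x))"
  obtain s p where sp: "q = (s, p)" "s \<in> I" "p \<in> D'" "p \<in> E'" using D E by auto
  have "smooth_at (\<phi>' p) (\<lambda>y. \<psi>' (inv_into D' \<phi>' y))"
    using smooth_map_atD(4)[OF smooth_map_at_ident[OF A] D(3) _ E(1)] sp chart_facts(6)[OF A D(3)]
    by simp
  then have "smooth_at (s, \<phi>' p) (\<lambda>z. (fst z, \<psi>' (inv_into D' \<phi>' (snd z))))"
    using smooth_at_compose[OF smooth_at_linear[OF bounded_linear_snd], of "(s, \<phi>' p)"
        "\<lambda>y. \<psi>' (inv_into D' \<phi>' y)"]
    by (intro smooth_at_Pair smooth_at_linear[OF bounded_linear_fst]) simp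
  then show "smooth_at (\<phi> q) (\<lambda>y. \<psi> (inv_into D \<phi> y))"
    unfolding D(4,5) sp(1)
    by (intro smooth_at_product_chart[OF A I D(3) sp(2,3), of \<psi>]) (simp add: case_prod_unfold E(3))
qed (use q IJ in \<open>auto simp: carrier_open_times\<close>)

lemma smooth_near_fst:
  fixes I :: "real set"
  assumes A: "smooth_manifold A" and I: "open I" and q: "q \<in> carrier (open_times I A)"
  shows "smooth_near (open_times I A) q fst"
proof -
  obtain s p where sp: "q = (s, p)" "s \<in> I" "p \<in> carrier A" using q by (auto simp: carrier_open_times)
  obtain D \<phi> where D: "(D, \<phi>) \<in> A" "p \<in> D" using carrierE sp(3) by metis
  have "smooth_at (s, \<phi> p) (\<lambda>z. fst z)"
    by (rule smooth_at_linear[OF bounded_linear_fst])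
  then show ?thesis
    using smooth_at_product_chart[OF A I D(1) sp(2) D(2), of fst] sp D
    by (subst smooth_near_iff[OF smooth_manifold_open_times[OF A I] open_times_chart[OF D(1)]])
      (auto simp: comp_def case_prod_unfold)
qed

text \<open>The lift of a vector field to the product: on each slice \<open>{s} \<times> M\<close> it is the image of the field
  under the inclusion \<open>x \<mapsto> (s, x)\<close>.\<close>

definition slice_lift ::
  "('m::topological_space, 'e::euclidean_space) chart set \<Rightarrow> 's::euclidean_space set \<Rightarrow>
   ('m \<Rightarrow> 'm tvec) \<Rightarrow> 's \<times> 'm \<Rightarrow> ('s \<times> 'm) tvec" where
  "slice_lift A I X = (\<lambda>(s, x). tmap (open_times I A) (\<lambda>y. (s, y)) x (X x))"

lemma slice_lift_vfield:
  fixes I :: "'s::euclidean_space set"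
  assumes A: "smooth_manifold A" and I: "open I" and X: "X \<in> \<XX> A"
  shows "slice_lift A I X \<in> \<XX> (open_times I A)"
proof -
  let ?B = "open_times I A"
  have B: "smooth_manifold ?B" using smooth_manifold_open_times[OF A I] .
  show ?thesis
    unfolding vfields_iff[OF B open_carrier[OF B] order_refl]
  proof (intro ballI conjI allI impI)
    fix q assume q: "q \<in> carrier ?B"
    obtain s p where sp: "q = (s, p)" "s \<in> I" "p \<in> carrier A" using q by (auto simp: carrier_open_times)
    show "slice_lift A I X q \<in> tangent_space ?B q"
      using tmap_tangent[OF A B smooth_map_at_slice[OF A sp(2,3)] global_vfieldsD(1)[OF A X sp(3)]]
      by (simp add: slice_lift_def sp(1))
    fix f assume f: "smooth_near ?B q f"
    obtain D \<phi> where D: "(D, \<phi>) \<in> A" "p \<in> D" using carrierE sp(3) by metis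
    note c = chart_facts[OF A D(1)]
    let ?\<Phi> = "\<lambda>(s, x). (s, \<phi> x)"
    note D2 = open_times_chart[OF D(1), of I]
    \<comment> \<open>In the product chart the lift has the components \<open>(0, X\<^sup>i)\<close>.\<close>
    have eq: "(\<Sum>i\<in>Basis. X (snd z) (\<lambda>x. \<phi> x \<bullet> i) * chart_vec ?B (I \<times> D) ?\<Phi> z (0, i) f) =
        slice_lift A I X z f" if z: "z \<in> I \<times> D" for z
    proof -
      obtain t x where tx: "z = (t, x)" "t \<in> I" "x \<in> D" using z by blast
      have xc: "x \<in> carrier A" using c(6) tx(3) .
      have ev: "tmap ?B (\<lambda>y. (t, y)) x (chart_vec A D \<phi> x i) f = chart_vec ?B (I \<times> D) ?\<Phi> z (0, i) f" for i
      proof -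
        have "frechet_derivative (\<lambda>y. ?\<Phi> (t, inv_into D \<phi> y)) (at (\<phi> x)) =
            frechet_derivative (\<lambda>y. (t, y)) (at (\<phi> x))"
          by (rule frechet_derivative_cong_open[OF c(2)]) (use tx in \<open>auto simp: c(7)\<close>)
        also have "\<dots> = (\<lambda>y. (0, y))"
          by (rule frechet_derivative_at[symmetric]) (auto intro!: derivative_eq_intros)
        finally show ?thesis
          using tmap_chart_vec[OF A B smooth_map_at_slice[OF A tx(2) xc] D(1) tx(3) D2, of i] tx by simp
      qed
      show ?thesis
      proof (cases "smooth_near ?B z f")
        case True
        then have "slice_lift A I X z f = X x (f \<circ> (\<lambda>y. (t, y)))"
          by (simp add: slice_lift_def tmap_def tx(1))
        also have "\<dots> = (\<Sum>i\<in>Basis. X x (\<lambda>x. \<phi> x \<bullet> i) * chart_vec A D \<phi> x i (f \<circ> (\<lambda>y. (t, y))))"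
          using tangent_expand[OF A D(1) tx(3) global_vfieldsD(1)[OF A X xc]] .
        also have "\<dots> = (\<Sum>i\<in>Basis. X x (\<lambda>x. \<phi> x \<bullet> i) * chart_vec ?B (I \<times> D) ?\<Phi> z (0, i) f)"
          using True ev[symmetric] by (simp add: tmap_def tx(1))
        finally show ?thesis by (simp add: tx(1))
      qed (simp add: slice_lift_def tmap_def tx(1) chart_vec_def)
    qed
    have "smooth_near ?B q (\<lambda>z. \<Sum>i\<in>Basis. X (snd z) (\<lambda>x. \<phi> x \<bullet> i) * chart_vec ?B (I \<times> D) ?\<Phi> z (0, i) f)"
    proof (intro smooth_near_sum[OF B q] smooth_near_mult[OF B])
      fix i :: 'b
      show "smooth_near ?B q (\<lambda>z. X (snd z) (\<lambda>x. \<phi> x \<bullet> i))"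
        using global_vfieldsD(2)[OF A X sp(3) smooth_near_coordinate[OF A D]] sp(1)
        by (intro smooth_near_compose[OF B A smooth_map_at_snd[OF A I q]]) simp
      show "smooth_near ?B q (\<lambda>z. chart_vec ?B (I \<times> D) ?\<Phi> z (0, i) f)"
        using smooth_near_chart_vec[OF B D2 _ f] sp D by simp
    qed
    then show "smooth_near ?B q (\<lambda>z. slice_lift A I X z f)"
    proof (rule smooth_near_cong[OF B])
      show "open (I \<times> D)" using I c(1) by (rule open_Times)
    qed (use sp D eq in auto)
  qed
qed


section \<open>Riemannian metrics and connections\<close>

lemma linear_connectionD:
  assumes "linear_connection A B F D" "v \<in> tangent_space A p" "W \<in> fields_along A B F (carrier A)"
  shows "D p v W \<in> tangent_space B (F p)"
    and "Z \<in> fields_along A B F (carrier A) \<Longrightarrow> D p v (\<lambda>q. W q + Z q) = D p v W + D p v Z"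
proof -
  have "\<forall>p\<in>carrier A. \<forall>v\<in>tangent_space A p. \<forall>W\<in>fields_along A B F (carrier A).
      D p v W \<in> tangent_space B (F p)"
    using assms(1) unfolding linear_connection_def Let_def by (elim conjE)
  then show "D p v W \<in> tangent_space B (F p)"
    using assms(2,3) tangent_space_carrier[OF assms(2)] by simp
  have "\<forall>p\<in>carrier A. \<forall>v\<in>tangent_space A p. \<forall>W\<in>fields_along A B F (carrier A).
      \<forall>Z\<in>fields_along A B F (carrier A). D p v (\<lambda>q. W q + Z q) = D p v W + D p v Z"
    using assms(1) unfolding linear_connection_def Let_def by (elim conjE)
  then show "D p v (\<lambda>q. W q + Z q) = D p v W + D p v Z" if "Z \<in> fields_along A B F (carrier A)"
    using that assms(2,3) tangent_space_carrier[OF assms(2)] by simp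
qed

lemma levi_civitaD:
  assumes "levi_civita A g nab"
  shows "linear_connection A A (\<lambda>x. x) nab"
    and "X \<in> \<XX> A \<Longrightarrow> Y \<in> \<XX> A \<Longrightarrow> p \<in> carrier A \<Longrightarrow>
      nab p (X p) Y - nab p (Y p) X = lie_bracket A X Y p"
    and "p \<in> carrier A \<Longrightarrow> v \<in> tangent_space A p \<Longrightarrow> Y \<in> \<XX> A \<Longrightarrow> Z \<in> \<XX> A \<Longrightarrow>
      v (\<lambda>q. g q (Y q) (Z q)) = g p (nab p v Y) (Z p) + g p (Y p) (nab p v Z)"
proof -
  have 1: "linear_connection A A (\<lambda>x. x) nab"
    and 2: "\<forall>X\<in>\<XX> A. \<forall>Y\<in>\<XX> A. \<forall>p\<in>carrier A.
        nab p (X p) Y - nab p (Y p) X = lie_bracket A X Y p"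
    and 3: "\<forall>p\<in>carrier A. \<forall>v\<in>tangent_space A p. \<forall>Y\<in>\<XX> A. \<forall>Z\<in>\<XX> A.
        v (\<lambda>q. g q (Y q) (Z q)) = g p (nab p v Y) (Z p) + g p (Y p) (nab p v Z)"
    using assms unfolding levi_civita_def by - (elim conjE; assumption)+
  show "linear_connection A A (\<lambda>x. x) nab" using 1 .
  show "nab p (X p) Y - nab p (Y p) X = lie_bracket A X Y p"
    if "X \<in> \<XX> A" "Y \<in> \<XX> A" "p \<in> carrier A"
    using 2[rule_format, OF that] .
  show "v (\<lambda>q. g q (Y q) (Z q)) = g p (nab p v Y) (Z p) + g p (Y p) (nab p v Z)"
    if "p \<in> carrier A" "v \<in> tangent_space A p" "Y \<in> \<XX> A" "Z \<in> \<XX> A"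
    using 3[rule_format, OF that] .
qed

lemma riemannian_metricD:
  assumes "riemannian_metric A g" and "u \<in> tangent_space A p" "v \<in> tangent_space A p" "w \<in> tangent_space A p"
  shows "g p (a *\<^sub>T u + b *\<^sub>T v) w = a * g p u w + b * g p v w"
    and "g p u v = g p v u" and "u \<noteq> 0 \<Longrightarrow> g p u u > 0"
proof -
  note p = tangent_space_carrier[OF assms(2)]
  have 1: "\<forall>p\<in>carrier A. \<forall>u\<in>tangent_space A p. \<forall>v\<in>tangent_space A p. \<forall>w\<in>tangent_space A p. \<forall>a b.
        g p (a *\<^sub>T u + b *\<^sub>T v) w = a * g p u w + b * g p v w"
    and 2: "\<forall>p\<in>carrier A. \<forall>v\<in>tangent_space A p. \<forall>w\<in>tangent_space A p. g p v w = g p w v"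
    and 3: "\<forall>p\<in>carrier A. \<forall>v\<in>tangent_space A p. v \<noteq> 0 \<longrightarrow> g p v v > 0"
    using assms(1) unfolding riemannian_metric_def by - (elim conjE; assumption)+
  show "g p (a *\<^sub>T u + b *\<^sub>T v) w = a * g p u w + b * g p v w"
    using 1[rule_format, OF p assms(2-4)] .
  show "g p u v = g p v u" using 2[rule_format, OF p assms(2,3)] .
  show "g p u u > 0" if "u \<noteq> 0" using 3[rule_format, OF p assms(2) that] .
qed

lemma metric_diff_left:
  assumes "riemannian_metric A g" "u \<in> tangent_space A p" "v \<in> tangent_space A p" "w \<in> tangent_space A p"
  shows "g p (u - v) w = g p u w - g p v w"
  using riemannian_metricD(1)[OF assms, of 1 "- 1"] by simp

lemma metric_nondegenerate:
  assumes "riemannian_metric A g" "u \<in> tangent_space A p" "\<And>w. w \<in> tangent_space A p \<Longrightarrow> g p u w = 0"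
  shows "u = 0"
  using riemannian_metricD(3)[OF assms(1,2,2,2)] assms(3)[OF assms(2)] by force

text \<open>Expansion of the first argument in the coordinate vectors of a chart.\<close>

lemma metric_expand:
  assumes A: "smooth_manifold A" and g: "riemannian_metric A g" and D: "(D, \<phi>) \<in> A" "p \<in> D"
    and v: "v \<in> tangent_space A p" and w: "w \<in> tangent_space A p"
  shows "g p v w = (\<Sum>i\<in>Basis. v (\<lambda>x. \<phi> x \<bullet> i) * g p (chart_vec A D \<phi> p i) w)"
proof -
  obtain y where y: "v = chart_vec A D \<phi> p y" using tangent_in_chart[OF A v D] .
  note t = chart_vec_tangent[OF D]
  have lin: "g p (chart_vec A D \<phi> p (a *\<^sub>R z + b *\<^sub>R z')) w =
      a * g p (chart_vec A D \<phi> p z) w + b * g p (chart_vec A D \<phi> p z') w" for a b z z'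
    using riemannian_metricD(1)[OF g t t w] chart_vec_linear[OF A D] by simp
  have "linear (\<lambda>z. g p (chart_vec A D \<phi> p z) w)"
    using lin[of 1 _ 1] lin[of _ _ 0] by (intro linearI) simp_all
  from linear_eq_sum_Basis[OF this, of y] show ?thesis
    unfolding y chart_vec_coordinate[OF A D] by simp
qed

lemma smooth_near_metric:
  assumes A: "smooth_manifold A" and g: "riemannian_metric A g" and U: "open U" "U \<subseteq> carrier A"
    and X: "X \<in> vfields A U" and Y: "Y \<in> vfields A U" and p: "p \<in> U"
  shows "smooth_near A p (\<lambda>x. g x (X x) (Y x))"
proof -
  have "\<forall>U. open U \<and> U \<subseteq> carrier A \<longrightarrow> (\<forall>X\<in>vfields A U. \<forall>Y\<in>vfields A U.
        smooth_fun A U (\<lambda>p. g p (X p) (Y p)))"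
    using g unfolding riemannian_metric_def by (elim conjE)
  then have "smooth_fun A U (\<lambda>x. g x (X x) (Y x))" using U X Y by simp
  then show ?thesis using p by (simp add: smooth_fun_iff[OF A U])
qed


section \<open>Geometry of the ambient manifold\<close>

text \<open>The data of the ambient construction: a manifold with a metric and an admissible family. The set
  \<open>c\<close> of metrics only enters as a parameter of admissibility.\<close>

locale ambient_space =
  fixes A :: "('m::{t2_space,second_countable_topology}, 'e::euclidean_space) chart set"
    and c :: "'m metric_tensor set"
    and g :: "'m metric_tensor"
    and \<gamma> :: "real \<Rightarrow> 'm \<Rightarrow> 'm tvec \<Rightarrow> 'm tvec"
    and \<delta> :: real
  assumes manifold: "smooth_manifold A" and metric: "riemannian_metric A g" and admissible: "admissible_family A c \<gamma> \<delta>"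
begin

abbreviation "B \<equiv> ambient_manifold \<delta> A"
abbreviation "G \<equiv> ambient_metric A g \<gamma>"
abbreviation slice :: "real \<Rightarrow> real \<Rightarrow> 'm \<Rightarrow> real \<times> real \<times> 'm" where "slice t r \<equiv> \<lambda>x. (t, r, x)"
abbreviation pr :: "real \<times> real \<times> 'm \<Rightarrow> 'm" where "pr \<equiv> \<lambda>(t, r, x). x"

lemma delta_pos: "0 < \<delta>"
  using admissible unfolding admissible_family_def by blast

lemma manifold_B: "smooth_manifold B"
  unfolding ambient_manifold_def by (intro smooth_manifold_open_times manifold) auto

lemma carrier_B: "carrier B = {0<..} \<times> {-\<delta><..<\<delta>} \<times> carrier A"
  by (simp add: ambient_manifold_def carrier_open_times)

lemma smooth_slice:
  assumes "0 < t" "\<bar>r\<bar> < \<delta>" "x \<in> carrier A"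
  shows "smooth_map_at A B (slice t r) x"
proof -
  have r: "r \<in> {-\<delta><..<\<delta>}" using assms(2) by auto
  show ?thesis
    unfolding ambient_manifold_def
    using assms r
    by (intro smooth_map_at_compose[of A "open_times {-\<delta><..<\<delta>} A" "\<lambda>x. (r, x)" _ _ "\<lambda>y. (t, y)"]
        smooth_map_at_slice smooth_manifold_open_times manifold) (auto simp: carrier_open_times)
qed

lemma smooth_pr:
  assumes "q \<in> carrier B"
  shows "smooth_map_at B A pr q"
proof -
  have "smooth_map_at B A (\<lambda>q. snd (snd q)) q"
    unfolding ambient_manifold_def
    using assms
    by (intro smooth_map_at_compose[of _ "open_times {-\<delta><..<\<delta>} A" snd _ _ snd]
        smooth_map_at_snd smooth_manifold_open_times manifold) (auto simp: carrier_B carrier_open_times)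
  then show ?thesis by (simp add: case_prod_unfold)
qed

lemma Psi_slice: "Psi = slice 1 0"
  by (auto simp: Psi_def)

lemma Psi_carrier: "x \<in> carrier A \<Longrightarrow> Psi x \<in> carrier B"
  using delta_pos by (simp add: carrier_B Psi_def)

lemma smooth_Psi: "x \<in> carrier A \<Longrightarrow> smooth_map_at A B Psi x"
  unfolding Psi_slice using smooth_slice delta_pos by simp

lemma pr_tangent: "v \<in> tangent_space B (Psi x) \<Longrightarrow> tmap A pr (Psi x) v \<in> tangent_space A x"
  using tmap_tangent[OF manifold_B manifold smooth_pr, of "Psi x" v] tangent_space_carrier[of v B "Psi x"]
  by (simp add: Psi_def)

lemma Psi_tangent: "v \<in> tangent_space A x \<Longrightarrow> tmap B Psi x v \<in> tangent_space B (Psi x)"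
  using tmap_tangent[OF manifold manifold_B smooth_Psi] tangent_space_carrier by blast

lemma pr_slice:
  assumes "0 < t" "\<bar>r\<bar> < \<delta>" "v \<in> tangent_space A x"
  shows "tmap A pr (t, r, x) (tmap B (slice t r) x v) = v"
proof -
  have "(t, r, x) \<in> carrier B"
    using assms tangent_space_carrier[OF assms(3)] by (auto simp: carrier_B)
  then show ?thesis
    using tmap_compose[OF manifold_B manifold smooth_pr, where F = "slice t r"] tmap_ident[OF assms(3)] by simp
qed

lemma pr_Psi: "v \<in> tangent_space A x \<Longrightarrow> tmap A pr (Psi x) (tmap B Psi x v) = v"
  using pr_slice[of 1 0] delta_pos by (simp add: Psi_slice)

lemma slice_differentials:
  assumes "v \<in> tangent_space A x"
  shows "tmap B (slice t r) x v (\<lambda>(t, r, x). r * t) = 0" "tmap B (slice t r) x v (\<lambda>(t, r, x). t) = 0"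
  using tangent_const[OF assms] by (auto simp: tmap_def comp_def)

lemma G_slice:
  assumes "0 < t" "\<bar>r\<bar> < \<delta>" "u \<in> tangent_space A x" "v \<in> tangent_space A x"
  shows "G (t, r, x) (tmap B (slice t r) x u) (tmap B (slice t r) x v) = t\<^sup>2 * g x (\<gamma> r x u) v"
  using slice_differentials[OF assms(3)] slice_differentials[OF assms(4)]
    pr_slice[OF assms(1,2,3)] pr_slice[OF assms(1,2,4)]
  by (simp add: ambient_metric_def Let_def)

lemma gamma_0: "v \<in> tangent_space A x \<Longrightarrow> \<gamma> 0 x v = v"
  using admissible tangent_space_carrier[of v A x] unfolding admissible_family_def by (elim conjE) simp

lemma gamma_tangent: "v \<in> tangent_space A x \<Longrightarrow> \<gamma> r x v \<in> tangent_space A x"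
  using admissible tangent_space_carrier[of v A x] unfolding admissible_family_def by (elim conjE) simp

text \<open>Along the immersion, the ambient product with a tangential vector only sees the projection to
  \<open>M\<close>.\<close>

lemma G_Psi:
  assumes "v \<in> tangent_space B (Psi x)" "w \<in> tangent_space A x"
  shows "G (Psi x) v (tmap B Psi x w) = g x (tmap A pr (Psi x) v) w"
    "G (Psi x) (tmap B Psi x w) v = g x w (tmap A pr (Psi x) v)"
  using slice_differentials[OF assms(2), of 1 0] pr_Psi[OF assms(2)]
    gamma_0[OF pr_tangent[OF assms(1)]] gamma_0[OF assms(2)]
  by (simp_all add: ambient_metric_def Let_def Psi_slice)

lemma tangent_part_eq:
  assumes W: "W x \<in> tangent_space B (Psi x)"
  shows "tangent_part A B G Psi W x = tmap A pr (Psi x) (W x)"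
proof -
  let ?v = "tmap A pr (Psi x) (W x)"
  have eq: "G (Psi x) (W x - tmap B Psi x u) (tmap B Psi x w) = g x (?v - u) w"
    if "u \<in> tangent_space A x" "w \<in> tangent_space A x" for u w
    using G_Psi(1)[OF tangent_diff[OF manifold_B W Psi_tangent[OF that(1)]] that(2)]
    by (simp add: tmap_diff pr_Psi[OF that(1)])
  have z: "g x 0 w = 0" if "w \<in> tangent_space A x" for w
    using metric_diff_left[OF metric that that that] by simp
  show ?thesis
    unfolding tangent_part_def
  proof (rule the_equality)
    show "?v \<in> tangent_space A x \<and>
        (\<forall>w\<in>tangent_space A x. G (Psi x) (W x - tmap B Psi x ?v) (tmap B Psi x w) = 0)"
      using pr_tangent[OF W] eq z by simp
    fix u assume u: "u \<in> tangent_space A x \<and>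
        (\<forall>w\<in>tangent_space A x. G (Psi x) (W x - tmap B Psi x u) (tmap B Psi x w) = 0)"
    have "?v - u = 0"
    proof (rule metric_nondegenerate[OF metric])
      show "?v - u \<in> tangent_space A x" using tangent_diff[OF manifold pr_tangent[OF W]] u by blast
      show "g x (?v - u) w = 0" if "w \<in> tangent_space A x" for w
        using u that by (simp flip: eq)
    qed
    then show "u = ?v" by simp
  qed
qed


subsection \<open>Lifts of vector fields\<close>

text \<open>The lift of a vector field on \<open>M\<close> to the ambient manifold, with vanishing components along the
  two interval factors. It extends the image of the vector field under the immersion.\<close>

definition lift :: "('m \<Rightarrow> 'm tvec) \<Rightarrow> real \<times> real \<times> 'm \<Rightarrow> (real \<times> real \<times> 'm) tvec" where
  "lift X = slice_lift (open_times {-\<delta><..<\<delta>} A) {0<..} (slice_lift A {-\<delta><..<\<delta>} X)"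

lemma lift_vfield: "X \<in> \<XX> A \<Longrightarrow> lift X \<in> \<XX> B"
  unfolding lift_def ambient_manifold_def
  by (intro slice_lift_vfield smooth_manifold_open_times manifold) auto

lemma lift_eq:
  assumes "0 < t" "\<bar>r\<bar> < \<delta>" "x \<in> carrier A"
  shows "lift X (t, r, x) = tmap B (slice t r) x (X x)"
proof -
  let ?A = "open_times {-\<delta><..<\<delta>} A"
  have "smooth_manifold ?A" using manifold by (intro smooth_manifold_open_times) auto
  then have "smooth_map_at ?A B (\<lambda>y. (t, y)) (r, x)"
    unfolding ambient_manifold_def using assms
    by (intro smooth_map_at_slice) (auto simp: carrier_open_times)
  from tmap_compose[OF \<open>smooth_manifold ?A\<close> manifold_B, of "\<lambda>y. (t, y)" "\<lambda>x. (r, x)" x "X x", OF this] show ?thesis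
    by (simp add: lift_def slice_lift_def ambient_manifold_def)
qed

lemma lift_Psi: "lift X (Psi x) = tmap B Psi x (X x)"
proof (cases "x \<in> carrier A")
  case True
  then show ?thesis using lift_eq[of 1 0 x X] delta_pos by (simp add: Psi_slice)
next
  case False
  \<comment> \<open>Off the carrier no function is smooth, so that both sides are the default value zero.\<close>
  then have "\<not> smooth_near B (1, 0, x) f" for f
    using smooth_near_carrier[of B "(1, 0, x)" f] by (auto simp: carrier_B)
  then show ?thesis
    by (auto simp: tmap_def lift_def slice_lift_def Psi_def simp flip: ambient_manifold_def)
qed

lemma lift_along_Psi_apply:
  assumes X: "X \<in> \<XX> A" and x: "x \<in> carrier A" and h: "smooth_near B (Psi x) h"
  shows "lift X (Psi x) h = X x (h \<circ> Psi)"
  using h by (simp add: lift_Psi tmap_def)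

lemma G_lift:
  assumes Y: "Y \<in> \<XX> A" and Z: "Z \<in> \<XX> A" and q: "0 < t" "\<bar>r\<bar> < \<delta>" "x \<in> carrier A"
  shows "G (t, r, x) (lift Y (t, r, x)) (lift Z (t, r, x)) = t\<^sup>2 * g x (\<gamma> r x (Y x)) (Z x)"
  using G_slice[OF q(1,2) global_vfieldsD(1)[OF manifold Y q(3)] global_vfieldsD(1)[OF manifold Z q(3)]]
  by (simp add: lift_eq[OF q])

text \<open>In a chart, \<open>g(\<gamma>(r) Y, Z)\<close> is the sum of the products of the coordinates of \<open>\<gamma>(r) Y\<close>, which are
  jointly smooth in \<open>r\<close> and the point by admissibility, with the products of the coordinate fields
  with \<open>Z\<close>. Smoothness is indispensable here, since the image of a tangent vector under a
  differential is zero on all functions that are not smooth near the image point.\<close>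

lemma smooth_near_G_lift:
  assumes Y: "Y \<in> \<XX> A" and Z: "Z \<in> \<XX> A" and q: "q \<in> carrier B"
  shows "smooth_near B q (\<lambda>q. G q (lift Y q) (lift Z q))"
proof -
  let ?I = "{0<..} :: real set" and ?J = "{-\<delta><..<\<delta>}"
  let ?A = "open_times ?J A" and ?R = "open_times (UNIV :: real set) A"
  have mA: "smooth_manifold ?A" and mR: "smooth_manifold ?R"
    using manifold by (auto intro: smooth_manifold_open_times)
  obtain t r p where trp: "q = (t, r, p)" "0 < t" "r \<in> ?J" "p \<in> carrier A"
    using q by (auto simp: carrier_B)
  obtain D \<phi> where D: "(D, \<phi>) \<in> A" "p \<in> D" using carrierE[OF trp(4)] .
  note c = chart_facts[OF manifold D(1)]
  have DA: "D \<subseteq> carrier A" using c(6) by blast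
  let ?a = "\<lambda>i (r, x). \<gamma> r x (Y x) (\<lambda>x. \<phi> x \<bullet> i)"
  let ?b = "\<lambda>i x. g x (chart_vec A D \<phi> x i) (Z x)"
  have snd: "smooth_map_at B ?R snd q"
  proof -
    have 1: "smooth_map_at B ?A snd q"
      using q unfolding ambient_manifold_def by (intro smooth_map_at_snd mA) auto
    have 2: "smooth_map_at ?A ?R (\<lambda>x. x) (snd q)"
      using trp manifold by (intro smooth_map_at_enlarge) (auto simp: carrier_open_times)
    show ?thesis using smooth_map_at_compose[OF manifold_B mA 1 2] by simp
  qed
  have a: "smooth_near B q (\<lambda>q. ?a i (snd q))" for i
  proof (rule smooth_near_compose[OF manifold_B mR snd])
    have "smooth_fun A D (\<lambda>x. \<phi> x \<bullet> i)"
      using smooth_near_coordinate[OF manifold D(1)] by (simp add: smooth_fun_iff[OF manifold c(1) DA])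
    moreover have "\<forall>U X f. open U \<and> U \<subseteq> carrier A \<and> X \<in> vfields A U \<and> smooth_fun A U f \<longrightarrow>
        smooth_fun ?R (UNIV \<times> U) (\<lambda>(r, p). \<gamma> r p (X p) f)"
      using admissible unfolding admissible_family_def by (elim conjE)
    ultimately have *: "smooth_fun ?R (UNIV \<times> D) (?a i)"
      using vfields_restrict[OF manifold Y c(1) DA] c(1) DA by simp
    have o: "open (UNIV \<times> D :: (real \<times> 'm) set)" "UNIV \<times> D \<subseteq> carrier ?R"
      using c(1) DA by (auto simp: open_Times carrier_open_times)
    show "smooth_near ?R (snd q) (?a i)"
      using * smooth_fun_iff[OF mR o] trp(1) D(2) by auto
  qed
  have b: "smooth_near B q (\<lambda>q. ?b i (pr q))" for i
    using smooth_near_metric[OF manifold metric c(1) DA chart_vec_vfield[OF manifold D(1)] vfields_restrict[OF manifold Z c(1) DA] D(2)]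
    by (intro smooth_near_compose[OF manifold_B manifold smooth_pr[OF q]]) (simp add: trp(1))
  have f: "smooth_near B q fst"
    using q unfolding ambient_manifold_def by (intro smooth_near_fst mA) auto
  have "smooth_near B q (\<lambda>q. (fst q * fst q) * (\<Sum>i\<in>Basis. ?a i (snd q) * ?b i (pr q)))"
    by (intro smooth_near_mult[OF manifold_B] f smooth_near_sum[OF manifold_B q] a b)
  then show ?thesis
  proof (rule smooth_near_cong[OF manifold_B])
    show "open (?I \<times> ?J \<times> D)" using c(1) by (intro open_Times) auto
    show "q \<in> ?I \<times> ?J \<times> D" using trp D(2) by auto
    fix q assume "q \<in> ?I \<times> ?J \<times> D"
    then obtain t r x where q: "q = (t, r, x)" "0 < t" "\<bar>r\<bar> < \<delta>" "x \<in> D" by auto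
    have x: "x \<in> carrier A" using c(6)[OF q(4)] .
    have "g x (\<gamma> r x (Y x)) (Z x) = (\<Sum>i\<in>Basis. ?a i (r, x) * ?b i x)"
      using metric_expand[OF manifold metric D(1) q(4) gamma_tangent[OF global_vfieldsD(1)[OF manifold Y x]]
          global_vfieldsD(1)[OF manifold Z x]] by simp
    then show "(fst q * fst q) * (\<Sum>i\<in>Basis. ?a i (snd q) * ?b i (pr q)) = G q (lift Y q) (lift Z q)"
      using G_lift[OF Y Z q(2,3) x] by (simp add: q(1) power2_eq_square)
  qed
qed

lemma deriv_G_lift:
  assumes X: "X \<in> \<XX> A" and Y: "Y \<in> \<XX> A" and Z: "Z \<in> \<XX> A" and x: "x \<in> carrier A"
  shows "lift X (Psi x) (\<lambda>q. G q (lift Y q) (lift Z q)) = X x (\<lambda>y. g y (Y y) (Z y))"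
proof -
  have "lift X (Psi x) (\<lambda>q. G q (lift Y q) (lift Z q)) = X x (\<lambda>y. G (Psi y) (lift Y (Psi y)) (lift Z (Psi y)))"
    using lift_along_Psi_apply[OF X x smooth_near_G_lift[OF Y Z Psi_carrier[OF x]]] by (simp add: comp_def)
  also have "\<dots> = X x (\<lambda>y. g y (Y y) (Z y))"
  proof (rule tangent_local[OF manifold global_vfieldsD(1)[OF manifold X x] open_carrier[OF manifold] x])
    fix y assume y: "y \<in> carrier A"
    show "G (Psi y) (lift Y (Psi y)) (lift Z (Psi y)) = g y (Y y) (Z y)"
      using G_lift[OF Y Z _ _ y, of 1 0] delta_pos gamma_0[OF global_vfieldsD(1)[OF manifold Y y]] by (simp add: Psi_def)
  qed
  finally show ?thesis .
qed

lemma bracket_lift: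
  assumes X: "X \<in> \<XX> A" and Y: "Y \<in> \<XX> A" and x: "x \<in> carrier A"
  shows "tmap A pr (Psi x) (lie_bracket B (lift X) (lift Y) (Psi x)) = lie_bracket A X Y x"
proof
  fix f
  show "tmap A pr (Psi x) (lie_bracket B (lift X) (lift Y) (Psi x)) f = lie_bracket A X Y x f"
  proof (cases "smooth_near A x f")
    case True
    have prPsi: "pr (Psi y) = y" for y by (simp add: Psi_def)
    have f: "smooth_near B (Psi y) (f \<circ> pr)" if "y \<in> carrier A" "smooth_near A y f" for y
      using smooth_near_compose[OF manifold_B manifold smooth_pr[OF Psi_carrier[OF that(1)]]] that(2)
      by (simp add: prPsi comp_def)
    obtain U where U: "open U" "x \<in> U" "U \<subseteq> carrier A" "\<And>y. y \<in> U \<Longrightarrow> smooth_near A y f"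
      by (rule smooth_near_open[OF manifold True]) blast
    have "lift X (Psi x) (\<lambda>q. lift Y q (f \<circ> pr)) = X x (\<lambda>y. Y y f)"
      if X: "X \<in> \<XX> A" and Y: "Y \<in> \<XX> A" for X Y
    proof -
      have "lift X (Psi x) (\<lambda>q. lift Y q (f \<circ> pr)) = X x (\<lambda>y. lift Y (Psi y) (f \<circ> pr))"
        using lift_along_Psi_apply[OF X x
            global_vfieldsD(2)[OF manifold_B lift_vfield[OF Y] Psi_carrier[OF x] f[OF x True]]]
        by (simp add: comp_def)
      also have "\<dots> = X x (\<lambda>y. Y y f)"
      proof (rule tangent_local[OF manifold global_vfieldsD(1)[OF manifold X x] U(1,2)])
        fix y assume "y \<in> U"
        then have y: "y \<in> carrier A" "smooth_near A y f" using U by auto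
        show "lift Y (Psi y) (f \<circ> pr) = Y y f"
          using lift_along_Psi_apply[OF Y y(1) f[OF y]] by (simp add: comp_def prPsi)
      qed
      finally show ?thesis .
    qed
    from this[OF X Y] this[OF Y X] show ?thesis
      using True f[OF x True] by (simp add: tmap_def lie_bracket_def prPsi)
  qed (simp add: tmap_def lie_bracket_def Psi_def)
qed


subsection \<open>The Gauss formula\<close>

text \<open>The tangential part of the ambient derivative of a tangential field is its Levi-Civita
  derivative: the difference of the two is symmetric in the differentiating and the differentiated
  field, and skew with respect to the metric in the last two arguments, so that it vanishes.\<close>

lemma gauss_formula:
  assumes nab: "levi_civita A g nab" and nab': "levi_civita B G nab'"
    and D: "pullback_connection A B Psi nab' D"
    and X: "X \<in> \<XX> A" and Y: "Y \<in> \<XX> A" and x: "x \<in> carrier A"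
  shows "tmap A pr (Psi x) (D x (X x) (\<lambda>q. tmap B Psi q (Y q))) = nab x (X x) Y"
proof -
  let ?p = "Psi x"
  note t = global_vfieldsD(1)[OF manifold _ x]
  note p = Psi_carrier[OF x]
  have nab_t: "nab x (X x) Y \<in> tangent_space A x" if "X \<in> \<XX> A" "Y \<in> \<XX> A" for X Y
    using linear_connectionD(1)[OF levi_civitaD(1)[OF nab] t[OF that(1)]] that(2)
    by (simp add: vfields_def)
  have nab'_t: "nab' ?p (lift X ?p) (lift Y) \<in> tangent_space B ?p" if "X \<in> \<XX> A" "Y \<in> \<XX> A" for X Y
    using linear_connectionD(1)[OF levi_civitaD(1)[OF nab'] global_vfieldsD(1)[OF manifold_B lift_vfield[OF that(1)] p]]
      lift_vfield[OF that(2)]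
    by (simp add: vfields_def)
  define P where "P X Y = tmap A pr ?p (nab' ?p (lift X ?p) (lift Y))" for X Y
  define T where "T X Y = P X Y - nab x (X x) Y" for X Y
  have P_t: "P X Y \<in> tangent_space A x" if "X \<in> \<XX> A" "Y \<in> \<XX> A" for X Y
    unfolding P_def using pr_tangent[OF nab'_t[OF that]] .
  have T_t: "T X Y \<in> tangent_space A x" if "X \<in> \<XX> A" "Y \<in> \<XX> A" for X Y
    unfolding T_def using tangent_diff[OF manifold P_t[OF that] nab_t[OF that]] .
  have sym: "T X Y = T Y X" if "X \<in> \<XX> A" "Y \<in> \<XX> A" for X Y
  proof -
    have "P X Y - P Y X = lie_bracket A X Y x"
      using levi_civitaD(2)[OF nab' lift_vfield[OF that(1)] lift_vfield[OF that(2)] p] bracket_lift[OF that x]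
      unfolding P_def by (simp flip: tmap_diff)
    also have "\<dots> = nab x (X x) Y - nab x (Y x) X"
      using levi_civitaD(2)[OF nab that x] by simp
    finally show ?thesis unfolding T_def by (simp add: algebra_simps)
  qed
  have skew: "g x (T X Y) (Z x) = - g x (T X Z) (Y x)"
    if "X \<in> \<XX> A" "Y \<in> \<XX> A" "Z \<in> \<XX> A" for X Y Z
  proof -
    have "lift X ?p (\<lambda>q. G q (lift Y q) (lift Z q)) =
        G ?p (nab' ?p (lift X ?p) (lift Y)) (lift Z ?p) + G ?p (lift Y ?p) (nab' ?p (lift X ?p) (lift Z))"
      using levi_civitaD(3)[OF nab' p global_vfieldsD(1)[OF manifold_B lift_vfield[OF that(1)] p]
        lift_vfield[OF that(2)] lift_vfield[OF that(3)]] .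
    also have "\<dots> = g x (P X Y) (Z x) + g x (Y x) (P X Z)"
      using G_Psi(1)[OF nab'_t[OF that(1,2)] t[OF that(3)]] G_Psi(2)[OF nab'_t[OF that(1,3)] t[OF that(2)]]
      by (simp add: P_def lift_Psi)
    finally have "X x (\<lambda>y. g y (Y y) (Z y)) = g x (P X Y) (Z x) + g x (Y x) (P X Z)"
      using deriv_G_lift[OF that x] by simp
    moreover have "X x (\<lambda>y. g y (Y y) (Z y)) = g x (nab x (X x) Y) (Z x) + g x (Y x) (nab x (X x) Z)"
      using levi_civitaD(3)[OF nab x t[OF that(1)] that(2,3)] .
    moreover have "g x (Y x) v = g x v (Y x)" if "v \<in> tangent_space A x" for v
      using riemannian_metricD(2)[OF metric t[OF \<open>Y \<in> \<XX> A\<close>] that that] .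
    ultimately show ?thesis
      using metric_diff_left[OF metric P_t[OF that(1,2)] nab_t[OF that(1,2)] t[OF that(3)]]
        metric_diff_left[OF metric P_t[OF that(1,3)] nab_t[OF that(1,3)] t[OF that(2)]]
        P_t[OF that(1,3)] nab_t[OF that(1,3)]
      unfolding T_def by simp
  qed
  have "T X Y = 0"
  proof (rule metric_nondegenerate[OF metric T_t[OF X Y]])
    fix w assume "w \<in> tangent_space A x"
    then obtain Z where Z: "Z \<in> \<XX> A" "Z x = w" using tangent_extends[OF manifold] by blast
    \<comment> \<open>Writing \<open>\<tau>(X, Y, Z)\<close> for \<open>g(T X Y, Z)\<close>: \<open>\<tau>(X, Y, Z) = - \<tau>(X, Z, Y) = - \<tau>(Z, X, Y) = \<tau>(Z, Y, X)
      = \<tau>(Y, Z, X) = - \<tau>(Y, X, Z) = - \<tau>(X, Y, Z)\<close>.\<close>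
    have "g x (T X Y) (Z x) = - g x (T X Y) (Z x)"
      using skew[OF X Y Z(1)] skew[OF Z(1) X Y] skew[OF Y Z(1) X] sym[OF X Y] sym[OF X Z(1)] sym[OF Y Z(1)]
      by simp
    then show "g x (T X Y) w = 0" using Z(2) by simp
  qed
  moreover have "D x (X x) (\<lambda>q. lift Y (Psi q)) = nab' ?p (lift X ?p) (lift Y)"
  proof -
    have "\<forall>p\<in>carrier A. \<forall>v\<in>tangent_space A p. \<forall>Y\<in>\<XX> B.
        D p v (\<lambda>q. Y (Psi q)) = nab' (Psi p) (tmap B Psi p v) Y"
      using D unfolding pullback_connection_def by (elim conjE)
    from this[rule_format, OF x t[OF X] lift_vfield[OF Y]] show ?thesis by (simp only: lift_Psi)
  qed
  ultimately show ?thesis by (simp add: T_def P_def lift_Psi)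
qed


subsection \<open>Tangential and normal parts of sections\<close>

lemma sections_iff:
  "W \<in> fields_along A B Psi (carrier A) \<longleftrightarrow> (\<forall>x\<in>carrier A. W x \<in> tangent_space B (Psi x) \<and>
     (\<forall>f. smooth_near B (Psi x) f \<longrightarrow> smooth_near A x (\<lambda>y. W y f)))"
  by (rule fields_along_iff[OF manifold manifold_B open_carrier[OF manifold] order_refl]) (rule smooth_map_atD(3)[OF smooth_Psi])

lemma tangent_part_vfield:
  assumes W: "W \<in> fields_along A B Psi (carrier A)"
  shows "tangent_part A B G Psi W \<in> \<XX> A"
  unfolding vfields_iff[OF manifold open_carrier[OF manifold] order_refl]
proof (intro ballI conjI allI impI)
  fix x assume x: "x \<in> carrier A"
  have Wt: "W y \<in> tangent_space B (Psi y)" if "y \<in> carrier A" for y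
    using W that by (simp add: sections_iff)
  show "tangent_part A B G Psi W x \<in> tangent_space A x"
    using pr_tangent[OF Wt[OF x]] tangent_part_eq[where W = W, OF Wt[OF x]] by simp
  fix f assume f: "smooth_near A x f"
  obtain U where U: "open U" "x \<in> U" "U \<subseteq> carrier A" "\<And>y. y \<in> U \<Longrightarrow> smooth_near A y f"
    by (rule smooth_near_open[OF manifold f]) blast
  have "smooth_near B (Psi x) (\<lambda>q. f (pr q))"
    using smooth_near_compose[OF manifold_B manifold smooth_pr[OF Psi_carrier[OF x]]] f by (simp add: Psi_def)
  then have "smooth_near A x (\<lambda>y. W y (\<lambda>q. f (pr q)))"
    using W x by (simp add: sections_iff)
  then show "smooth_near A x (\<lambda>y. tangent_part A B G Psi W y f)"
  proof (rule smooth_near_cong[OF manifold _ U(1,2)])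
    fix y assume y: "y \<in> U"
    then have "y \<in> carrier A" using U(3) by blast
    then show "W y (\<lambda>q. f (pr q)) = tangent_part A B G Psi W y f"
      using U(4)[OF y] by (simp add: tangent_part_eq[where W = W, OF Wt] tmap_def comp_def Psi_def)
  qed
qed

lemma tangent_image_section:
  assumes Z: "Z \<in> \<XX> A"
  shows "(\<lambda>x. tmap B Psi x (Z x)) \<in> fields_along A B Psi (carrier A)"
proof -
  have "smooth_near A x (\<lambda>y. lift Z (Psi y) f)" if "x \<in> carrier A" "smooth_near B (Psi x) f" for x f
    using smooth_near_compose[OF manifold manifold_B smooth_Psi[OF that(1)]
        global_vfieldsD(2)[OF manifold_B lift_vfield[OF Z] Psi_carrier[OF that(1)] that(2)]] .
  then show ?thesis
    using Psi_tangent[OF global_vfieldsD(1)[OF manifold Z]] by (simp add: sections_iff lift_Psi)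
qed

lemma normal_part_section:
  assumes W: "W \<in> fields_along A B Psi (carrier A)"
  shows "normal_part A B G Psi W \<in> fields_along A B Psi (carrier A)"
proof -
  let ?Z = "\<lambda>x. tmap B Psi x (tangent_part A B G Psi W x)"
  have Z: "?Z \<in> fields_along A B Psi (carrier A)"
    using tangent_image_section[OF tangent_part_vfield[OF W]] .
  show ?thesis
    unfolding sections_iff
  proof (intro ballI conjI allI impI)
    fix x assume x: "x \<in> carrier A"
    show "normal_part A B G Psi W x \<in> tangent_space B (Psi x)"
      using W Z x unfolding sections_iff normal_part_def by (intro tangent_diff[OF manifold_B]) auto
    fix f assume f: "smooth_near B (Psi x) f"
    have "smooth_near A x (\<lambda>y. W y f + (- 1) * ?Z y f)"
      using W Z x f unfolding sections_iff
      by (intro smooth_near_add smooth_near_mult smooth_near_const manifold) auto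
    then show "smooth_near A x (\<lambda>y. normal_part A B G Psi W y f)" by (simp add: normal_part_def)
  qed
qed

lemma connection_splits:
  assumes D: "linear_connection A B Psi D" and W: "W \<in> fields_along A B Psi (carrier A)"
    and v: "v \<in> tangent_space A x"
  shows "D x v W = D x v (\<lambda>q. tmap B Psi q (tangent_part A B G Psi W q)) + D x v (normal_part A B G Psi W)"
proof -
  have "W = (\<lambda>q. tmap B Psi q (tangent_part A B G Psi W q) + normal_part A B G Psi W q)"
    by (simp add: normal_part_def)
  then show ?thesis
    using linear_connectionD(2)[OF D v tangent_image_section[OF tangent_part_vfield[OF W]] normal_part_section[OF W]]
    by simp
qed

text \<open>The pointwise form of the result: for fixed \<open>V\<close> and \<open>x\<close>, the two equations are the tangential
  and the normal part of \<open>D V W = 0\<close> at \<open>x\<close>.\<close>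

lemma parallel_iff:
  assumes nab: "levi_civita A g nab" and nab': "levi_civita B G nab'"
    and pb: "pullback_connection A B Psi nab' D"
    and W: "W \<in> fields_along A B Psi (carrier A)" and V: "V \<in> \<XX> A" and x: "x \<in> carrier A"
  defines "Wtan \<equiv> tangent_part A B G Psi W" and "Wnor \<equiv> normal_part A B G Psi W"
  shows "D x (V x) W = 0 \<longleftrightarrow> nab x (V x) Wtan = weingarten A B G Psi D Wnor V x \<and>
    second_fundamental_form A B G Psi D V Wtan x + normal_connection A B G Psi D V Wnor x = 0"
proof -
  have D: "linear_connection A B Psi D" using pb unfolding pullback_connection_def by blast
  note v = global_vfieldsD(1)[OF manifold V x]
  let ?Z = "\<lambda>q. tmap B Psi q (Wtan q)"
  let ?pr = "tmap A pr (Psi x)"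
  define P where "P = D x (V x) ?Z"
  define Q where "Q = D x (V x) Wnor"
  have P_t: "P \<in> tangent_space B (Psi x)"
    unfolding P_def Wtan_def
    using linear_connectionD(1)[OF D v tangent_image_section[OF tangent_part_vfield[OF W]]] .
  have Q_t: "Q \<in> tangent_space B (Psi x)"
    unfolding Q_def Wnor_def using linear_connectionD(1)[OF D v normal_part_section[OF W]] .
  have split: "D x (V x) W = P + Q"
    unfolding P_def Q_def Wtan_def Wnor_def using connection_splits[OF D W v] .
  have P_tan: "tangent_part A B G Psi (\<lambda>x. D x (V x) ?Z) x = ?pr P"
    using tangent_part_eq[of "\<lambda>x. D x (V x) ?Z" x] P_t by (simp add: P_def)
  have Q_tan: "tangent_part A B G Psi (\<lambda>x. D x (V x) Wnor) x = ?pr Q"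
    using tangent_part_eq[of "\<lambda>x. D x (V x) Wnor" x] Q_t by (simp add: Q_def)
  have "?pr P = nab x (V x) Wtan"
    unfolding P_def Wtan_def
    using gauss_formula[OF nab nab' pb V tangent_part_vfield[OF W] x] .
  moreover have "weingarten A B G Psi D Wnor V x = - ?pr Q"
    by (simp add: weingarten_def Q_tan)
  moreover have "second_fundamental_form A B G Psi D V Wtan x = P - tmap B Psi x (?pr P)"
    by (simp add: second_fundamental_form_def normal_part_def P_tan flip: P_def)
  moreover have "normal_connection A B G Psi D V Wnor x = Q - tmap B Psi x (?pr Q)"
    by (simp add: normal_connection_def normal_part_def Q_tan flip: Q_def)
  moreover have "P + Q = 0 \<longleftrightarrow> ?pr P = - ?pr Q \<and>
      (P - tmap B Psi x (?pr P)) + (Q - tmap B Psi x (?pr Q)) = 0"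
  proof -
    have eq: "(P - tmap B Psi x (?pr P)) + (Q - tmap B Psi x (?pr Q)) = P + Q - tmap B Psi x (?pr P + ?pr Q)"
      by (simp add: tmap_add algebra_simps)
    have "?pr P + ?pr Q = 0" if "P + Q = 0"
      using tmap_add[of A pr "Psi x" P Q] that by (simp add: tmap_zero)
    then show ?thesis
      unfolding eq by (auto simp: tmap_zero eq_neg_iff_add_eq_0)
  qed
  ultimately show ?thesis using split by simp
qed

end


section \<open>Parallel sections of the tractor bundle\<close>

theorem proposition6p1:
  fixes A :: "('m::{t2_space,second_countable_topology}, 'e::euclidean_space) chart set"
    and c :: "'m metric_tensor set"
    and g :: "'m metric_tensor"
    and \<gamma> :: "real \<Rightarrow> 'm \<Rightarrow> 'm tvec \<Rightarrow> 'm tvec"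
    and \<delta> :: real
    and nab :: "('m, 'm) connection"
    and nab_amb :: "(real \<times> real \<times> 'm, real \<times> real \<times> 'm) connection"
    and D :: "('m, real \<times> real \<times> 'm) connection"
    and W :: "'m \<Rightarrow> (real \<times> real \<times> 'm) tvec"
  defines "B \<equiv> ambient_manifold \<delta> A"
    and "G \<equiv> ambient_metric A g \<gamma>"
  defines "T \<equiv> associated_tractor_bundle A B G Psi (xi_field A \<delta>) D"
    and "Wtan \<equiv> tangent_part A B G Psi W"
    and "Wnor \<equiv> normal_part A B G Psi W"
  assumes "smooth_manifold A" and "connected (carrier A)" and "DIM('e) \<ge> 3"
    and "riemannian_conformal_structure A c" and "g \<in> c"
    and "admissible_family A c \<gamma> \<delta>"
    and "levi_civita A g nab"
    and "\<forall>p\<in>carrier A. \<forall>v\<in>tangent_space A p. \<forall>w\<in>tangent_space A p.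
           g p (family_deriv \<gamma> 0 p v) w = 2 * schouten A g nab p v w"
    and "levi_civita B G nab_amb"
    and "pullback_connection A B Psi nab_amb D"
    and "W \<in> sections T"
  shows "parallel_section A T W \<longleftrightarrow>
    (\<forall>V\<in>\<XX> A.
       (\<forall>x\<in>carrier A. nab x (V x) Wtan = weingarten A B G Psi D Wnor V x) \<and>
       (\<forall>x\<in>carrier A. second_fundamental_form A B G Psi D V Wtan x
                        + normal_connection A B G Psi D V Wnor x = 0))"
proof -
  have g: "riemannian_metric A g"
    using \<open>riemannian_conformal_structure A c\<close> \<open>g \<in> c\<close>
    unfolding riemannian_conformal_structure_def by blast
  interpret ambient_space A c g \<gamma> \<delta>
    by unfold_locales fact+
  have W: "W \<in> fields_along A B Psi (carrier A)"
    using \<open>W \<in> sections T\<close> by (simp add: T_def associated_tractor_bundle_def)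
  have "parallel_section A T W \<longleftrightarrow> (\<forall>V\<in>\<XX> A. \<forall>x\<in>carrier A. D x (V x) W = 0)"
    using W by (simp add: parallel_section_def T_def associated_tractor_bundle_def)
  then show ?thesis
    using parallel_iff[OF \<open>levi_civita A g nab\<close> _ _ W[unfolded B_def]]
      \<open>levi_civita B G nab_amb\<close> \<open>pullback_connection A B Psi nab_amb D\<close>
    unfolding B_def G_def Wtan_def Wnor_def by blast
qed

end
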